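(* Let $G$ be a weighted network with $n$ cells, and consider the set $\mathcal L_{W_G}\cup\mathcal L_{L_G}$ of the synchrony and anti-synchrony subspaces of $G$, that is, the set of generalized polydiagonal subspaces of $\mathbb{R}^n$ that are left invariant by the adjacency matrix $W_G$ or by the Laplacian matrix $L_G$ of $G$. Let $\Delta_{\mathcal P}\in\mathcal L_{W_G}\cup\mathcal L_{L_G}$, with associated tagged partition $\mathcal P$. Then: (i.a) $\Delta_{\mathcal P}$ is a synchrony subspace for every system in $I_G$ if and only if $\mathcal P$ is balanced; likewise, $\Delta_{\mathcal P}$ is a synchrony subspace for every system in $I_{G,eo}$ if and only if $\mathcal P$ is balanced. (i.b) For each of the classes $I_{G,0}$, $I_{G,odd}$, $I_{G,l}$: $\Delta_{\mathcal P}$ is a synchrony subspace for every system in that class if and only if $\mathcal P$ is exo-balanced. (ii.a) $\Delta_{\mathcal P}$ is an anti-synchrony subspace for every system in $I_{G,odd}$ if and only if $\mathcal P$ is odd-balanced. (ii.b) $\Delta_{\mathcal P}$ is an anti-synchrony subspace for every system in $I_{G,l}$ if and only if $\mathcal P$ is linear-balanced. (ii.c) $\Delta_{\mathcal P}$ is an anti-synchrony subspace for every system in $I_{G,eo}$ if and only if $\mathcal P$ is even-odd-balanced.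
   Context: A weighted network $G$ with set of cells $C=\{1,\ldots,n\}$ is a directed graph with real edge weights. Its adjacency matrix is $W_G=[w_{ij}]\in\mathbb{R}^{n\times n}$, where $w_{ij}$ is the weight of the edge from cell $j$ to cell $i$ (zero if there is no such edge; self-loops allowed). The Laplacian matrix is $L_G=D_G-W_G$, where $D_G$ is the diagonal matrix whose $i$-th diagonal entry is the input valency $v(i)=\sum_{j\in C}w_{ij}$. Tagged partition: let $p,q,r$ be nonnegative integers with $0\le q\le p\le n$, $r\in\{0,1\}$. A tagged partition $\mathcal P$ of $C$ determined by $p,q,r$ is a partition of $C$ into $p+q+r$ disjoint nonempty parts: $P_1,\ldots,P_p$; $\overline P_1,\ldots,\overline P_q$, where $\overline P_l$ is called the counterpart of $P_l$ (and conversely); and, if $r=1$, a part $P_0$ called the zero part. It is standard if $q=0$ and $r=0$. With cell phase space $\mathbb{R}^k$, the generalized polydiagonal associated with $\mathcal P$ is $\Delta_{\mathcal P}=\{x\in(\mathbb{R}^k)^n: x_j=x_i$ if $j$ is in the same part as $i$; $x_j=-x_i$ if $j$ is in the counterpart of the part of $i$; $x_j=0$ if $j\in P_0\}$. It is a polydiagonal if $\mathcal P$ is standard. A matrix $M$ leaves a subspace $\Delta\subseteq\mathbb{R}^n$ invariant if $M\Delta\subseteq\Delta$. Systems: for $k\ge1$, $I_G$ is the set of systems $\dot x=f(x)$ on $(\mathbb{R}^k)^n$ of the form $\dot x_j=g(x_j)+\sum_{i=1}^n w_{ji}h(x_j,x_i)$, $j=1,\ldots,n$, with $g:\mathbb{R}^k\to\mathbb{R}^k$,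 $h:\mathbb{R}^k\times\mathbb{R}^k\to\mathbb{R}^k$ smooth. Subsets: $I_{G,0}$: $h(x,x)=0$ for all $x$; $I_{G,odd}$: in $I_{G,0}$ with $g$ odd and $h$ odd ($h(-x,-y)=-h(x,y)$); $I_{G,l}$: in $I_{G,0}$ with $g$ odd and $h$ linear; $I_{G,eo}$: in $I_G$ with $g$ odd and $h(-x,y)=h(x,y)$, $h(x,-y)=-h(x,y)$ for all $x,y$. $\Delta_{\mathcal P}$ is a synchrony (resp. anti-synchrony) subspace for every system in a class if $\mathcal P$ is standard (resp. not standard) and, for every choice of total phase space $(\mathbb{R}^k)^n$ ($k\ge 1$), $\Delta_{\mathcal P}$ is left invariant under the flow of every system in the class, i.e. every solution starting in $\Delta_{\mathcal P}$ stays in $\Delta_{\mathcal P}$ on its interval of existence. A standard partition $\mathcal P$ is balanced (resp. exo-balanced) if $\Delta_{\mathcal P}\subseteq\mathbb{R}^n$ ($k=1$) is left invariant by $W_G$ (resp. $L_G$). A non-standard tagged partition $\mathcal P$ is even-odd-balanced (resp. linear-balanced) if $\Delta_{\mathcal P}\subseteq\mathbb{R}^n$ is left invariant by $W_G$ (resp. $L_G$). Odd-balanced: write $W[A,B]$ for the submatrix of $W_G$ with rows in $A$, columns in $B$, and $Q_{ij}=W[P_i,P_j]$, $R_{ij}=W[P_i,\overline P_j]$, $Z_{i0}=W[P_i,P_0]$, $\overline R_{ij}=W[\overline P_i,P_j]$, $\overline Q_{ij}=W[\overline P_i,\overline P_j]$, $\overline Z_{i0}=W[\overline P_i,P_0]$,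 $Z_{0j}=W[P_0,P_j]$, $\overline Z_{0j}=W[P_0,\overline P_j]$, $Z_{00}=W[P_0,P_0]$. Let $\mathrm{rs}(B)$ be the column vector of row sums of $B$; $B$ is regular of valency $v$ if all its row sums equal $v$. A non-standard tagged partition $\mathcal P$ is odd-balanced if: (a) all blocks, excluding the blocks $Q_{ii},\overline Q_{ii},Z_{0j},\overline Z_{0j},Z_{00}$, are regular; (b) if $q>0$, for $1\le i,j\le q$ each pair of blocks $Q_{ij},\overline Q_{ij}$ (for $i\ne j$), $R_{ij},\overline R_{ij}$, and $Z_{i0},\overline Z_{i0}$ has the same valency; (c) if $q>0$ and $r=1$, $\mathrm{rs}(Z_{0j})=\mathrm{rs}(\overline Z_{0j})$ for $1\le j\le q$; (d) if $r=1$, $\mathrm{rs}(Z_{0j})=0$ for $q+1\le j\le p$.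
   Formalization: The definition of odd-balanced is given one further condition, without which (ii.a) is false: for 1 ≤ i ≤ q < j ≤ p, the blocks Q_ij = W[P_i, P_j] and \overline R_ij = W[\overline P_i, P_j] have valency 0. *)

theory Defs
  imports "HOL-Analysis.Analysis" "HOL-Library.Function_Algebras"
begin

section \<open>Tagged partitions and generalized polydiagonals\<close>

text \<open>A weighted network on the cells \<open>'n\<close> is given by its adjacency matrix
  \<open>W :: real^'n^'n\<close>; \<open>W $ i $ j\<close> is the weight of the edge from \<open>j\<close> to \<open>i\<close>.\<close>

definition laplacian :: "real^'n^'n \<Rightarrow> real^'n^'n" where
  "laplacian W = (\<chi> i j. if i = j then \<Sum>l\<in>UNIV. W $ i $ l else 0) - W"

datatype tag = Part nat | Counterpart nat | Zero

text \<open>\<open>parts_of \<P>\<close> is only meaningful on \<open>tags \<P>\<close>: the parts are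
  $P_i$ = \<open>parts_of \<P> (Part i)\<close> for \<open>1 \<le> i \<le> p\<close>,
  $\overline P_i$ = \<open>parts_of \<P> (Counterpart i)\<close> for \<open>1 \<le> i \<le> q\<close> and, if \<open>r = 1\<close>,
  $P_0$ = \<open>parts_of \<P> Zero\<close>.\<close>

record 'n tagged_partition =
  p_of :: nat
  q_of :: nat
  r_of :: nat
  parts_of :: "tag \<Rightarrow> 'n set"

definition tags :: "'n tagged_partition \<Rightarrow> tag set" where
  "tags \<P> = Part ` {1..p_of \<P>} \<union> Counterpart ` {1..q_of \<P>} \<union> (if r_of \<P> = 1 then {Zero} else {})"

definition is_tagged_partition :: "('n::finite) tagged_partition \<Rightarrow> bool" where
  "is_tagged_partition \<P> \<longleftrightarrow>
     q_of \<P> \<le> p_of \<P> \<and> p_of \<P> \<le> CARD('n) \<and> r_of \<P> \<in> {0, 1} \<and>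
     (\<forall>T\<in>tags \<P>. parts_of \<P> T \<noteq> {}) \<and>
     disjoint_family_on (parts_of \<P>) (tags \<P>) \<and>
     (\<Union>T\<in>tags \<P>. parts_of \<P> T) = UNIV"

definition is_standard :: "'n tagged_partition \<Rightarrow> bool" where
  "is_standard \<P> \<longleftrightarrow> q_of \<P> = 0 \<and> r_of \<P> = 0"

definition gen_polydiagonal :: "'n tagged_partition \<Rightarrow> ('n \<Rightarrow> 'v::{zero,uminus}) set" where
  "gen_polydiagonal \<P> = {x.
     (\<forall>T\<in>tags \<P>. \<forall>i\<in>parts_of \<P> T. \<forall>j\<in>parts_of \<P> T. x j = x i) \<and>
     (\<forall>l\<in>{1..q_of \<P>}. \<forall>i\<in>parts_of \<P> (Part l). \<forall>j\<in>parts_of \<P> (Counterpart l). x j = - x i) \<and>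
     (r_of \<P> = 1 \<longrightarrow> (\<forall>j\<in>parts_of \<P> Zero. x j = 0))}"

text \<open>$\Delta_{\mathcal P}$ in $\mathbb R^n$.\<close>

definition polydiagonal :: "'n tagged_partition \<Rightarrow> (real^'n) set" where
  "polydiagonal \<P> = {x. ($) x \<in> gen_polydiagonal \<P>}"

text \<open>The dimension \<open>k\<close> of the cell phase space is quantified inside the notions below, so
  $\mathbb R^k$ is the carrier of the library's \<open>Euclidean_space k\<close>, i.e. the set of all
  \<open>x :: nat \<Rightarrow> real\<close> with \<open>x a = 0\<close> for \<open>a \<ge> k\<close>.\<close>

abbreviation Rsp :: "nat \<Rightarrow> (nat \<Rightarrow> real) set" where
  "Rsp k \<equiv> topspace (Euclidean_space k)"

definition polydiagonal_k :: "nat \<Rightarrow> 'n tagged_partition \<Rightarrow> ('n \<Rightarrow> nat \<Rightarrow> real) set" where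
  "polydiagonal_k k \<P> = {x \<in> gen_polydiagonal \<P>. \<forall>i. x i \<in> Rsp k}"

definition leaves_invariant :: "real^'n^'n \<Rightarrow> (real^'n) set \<Rightarrow> bool" where
  "leaves_invariant M S \<longleftrightarrow> (\<lambda>x. M *v x) ` S \<subseteq> S"

definition invariant_polydiagonals :: "real^'n^'n \<Rightarrow> (real^('n::finite)) set set" where
  "invariant_polydiagonals M =
     {S. \<exists>\<P>. is_tagged_partition \<P> \<and> S = polydiagonal \<P> \<and> leaves_invariant M S}"


section \<open>Balanced partitions\<close>

definition balanced :: "real^'n^'n \<Rightarrow> 'n tagged_partition \<Rightarrow> bool" where
  "balanced W \<P> \<longleftrightarrow> is_standard \<P> \<and> leaves_invariant W (polydiagonal \<P>)"

definition exo_balanced :: "real^'n^'n \<Rightarrow> 'n tagged_partition \<Rightarrow> bool" where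
  "exo_balanced W \<P> \<longleftrightarrow> is_standard \<P> \<and> leaves_invariant (laplacian W) (polydiagonal \<P>)"

definition even_odd_balanced :: "real^'n^'n \<Rightarrow> 'n tagged_partition \<Rightarrow> bool" where
  "even_odd_balanced W \<P> \<longleftrightarrow> \<not> is_standard \<P> \<and> leaves_invariant W (polydiagonal \<P>)"

definition linear_balanced :: "real^'n^'n \<Rightarrow> 'n tagged_partition \<Rightarrow> bool" where
  "linear_balanced W \<P> \<longleftrightarrow> \<not> is_standard \<P> \<and> leaves_invariant (laplacian W) (polydiagonal \<P>)"

text \<open>The sum of row \<open>i\<close> of a submatrix of \<open>W\<close> with columns in \<open>B\<close>.\<close>

definition rs :: "real^'n^'n \<Rightarrow> 'n set \<Rightarrow> 'n \<Rightarrow> real" where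
  "rs W B i = (\<Sum>j\<in>B. W $ i $ j)"

text \<open>\<open>block_valency W \<P> S T v\<close>: the block of \<open>W\<close> with rows in part \<open>S\<close> and columns in
  part \<open>T\<close> is regular of valency \<open>v\<close>.\<close>

definition block_valency ::
    "real^'n^'n \<Rightarrow> 'n tagged_partition \<Rightarrow> tag \<Rightarrow> tag \<Rightarrow> real \<Rightarrow> bool" where
  "block_valency W \<P> S T v \<longleftrightarrow> (\<forall>i\<in>parts_of \<P> S. rs W (parts_of \<P> T) i = v)"

definition same_valency ::
    "real^'n^'n \<Rightarrow> 'n tagged_partition \<Rightarrow> tag \<times> tag \<Rightarrow> tag \<times> tag \<Rightarrow> bool" where
  "same_valency W \<P> A B \<longleftrightarrow>
     (\<exists>v. block_valency W \<P> (fst A) (snd A) v \<and> block_valency W \<P> (fst B) (snd B) v)"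

text \<open>In the notation $Q_{ij}, R_{ij}, Z_{i0}, \overline R_{ij}, \overline Q_{ij},
  \overline Z_{i0}, Z_{0j}, \overline Z_{0j}, Z_{00}$ for the blocks, the conjuncts say:
  all blocks other than $Q_{ii}, \overline Q_{ii}, Z_{0j}, \overline Z_{0j}, Z_{00}$ are regular;
  $Q_{ij}, \overline Q_{ij}$ (for $i \neq j$), and $R_{ij}, \overline R_{ij}$, and
  $Z_{i0}, \overline Z_{i0}$ have the same valency;
  $Z_{0j}, \overline Z_{0j}$ have the same row sums for $j \le q$;
  $Z_{0j}$ has zero row sums for $j > q$.

  The last conjunct ($Q_{ij}$ and $\overline R_{ij}$ have valency $0$ for $i \le q < j$) is not in
  the source's list of conditions. It is added because the characterization of anti-synchrony for
  \<open>I_Godd\<close> is false without it: if $P_j$ has no counterpart, the terms $h(x_i,x_j)$ and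
  $h(-x_i,x_j) = -h(x_i,-x_j)$ arising in $P_i$ and $\overline P_i$ are independent for generic
  odd $h$, so each must have zero coefficient. For example, with $P_1 = \{1\}$,
  $\overline P_1 = \{2\}$, $P_2 = \{3\}$, $w_{13} = 1$, $w_{23} = -1$ and all other weights zero,
  the polydiagonal $x_2 = -x_1$ is invariant under $W$ and satisfies all other conjuncts, but for $g = 0$,
  $h(x,y) = x - y$ it contains the initial value $(0,0,1)$ but not the solution
  $(1-e^t, 1-e^{-t}, 1)$ for $t \neq 0$.\<close>

definition odd_balanced :: "real^'n^'n \<Rightarrow> 'n tagged_partition \<Rightarrow> bool" where
  "odd_balanced W \<P> \<longleftrightarrow> \<not> is_standard \<P> \<and>
     (\<forall>S\<in>tags \<P>. \<forall>T\<in>tags \<P>. S \<noteq> T \<and> S \<noteq> Zero \<longrightarrow> (\<exists>v. block_valency W \<P> S T v)) \<and>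
     (\<forall>i\<in>{1..q_of \<P>}. \<forall>j\<in>{1..q_of \<P>}.
        (i \<noteq> j \<longrightarrow> same_valency W \<P> (Part i, Part j) (Counterpart i, Counterpart j)) \<and>
        same_valency W \<P> (Part i, Counterpart j) (Counterpart i, Part j)) \<and>
     (r_of \<P> = 1 \<longrightarrow> (\<forall>i\<in>{1..q_of \<P>}. same_valency W \<P> (Part i, Zero) (Counterpart i, Zero))) \<and>
     (r_of \<P> = 1 \<longrightarrow> (\<forall>j\<in>{1..q_of \<P>}. \<forall>i\<in>parts_of \<P> Zero.
        rs W (parts_of \<P> (Part j)) i = rs W (parts_of \<P> (Counterpart j)) i)) \<and>
     (r_of \<P> = 1 \<longrightarrow> (\<forall>j\<in>{q_of \<P> + 1..p_of \<P>}. \<forall>i\<in>parts_of \<P> Zero.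
        rs W (parts_of \<P> (Part j)) i = 0)) \<and>
     (\<forall>i\<in>{1..q_of \<P>}. \<forall>j\<in>{q_of \<P> + 1..p_of \<P>}.
        block_valency W \<P> (Part i) (Part j) 0 \<and> block_valency W \<P> (Counterpart i) (Part j) 0)"


section \<open>Smooth maps between the spaces of arbitrary dimension\<close>

text \<open>\<open>C_m k m F\<close>: on $\mathbb R^k$, all partial derivatives of \<open>F\<close> of order up to \<open>m\<close>
  exist and are continuous.\<close>

fun C_m :: "nat \<Rightarrow> nat \<Rightarrow> ((nat \<Rightarrow> real) \<Rightarrow> real) \<Rightarrow> bool" where
  "C_m k 0 F \<longleftrightarrow> continuous_map (Euclidean_space k) euclideanreal F"
| "C_m k (Suc m) F \<longleftrightarrow> continuous_map (Euclidean_space k) euclideanreal F \<and>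
     (\<forall>a<k. (\<forall>x\<in>Rsp k. (\<lambda>t. F (x(a := t))) differentiable at (x a)) \<and>
            C_m k m (\<lambda>x. deriv (\<lambda>t. F (x(a := t))) (x a)))"

definition smooth_map :: "nat \<Rightarrow> nat \<Rightarrow> ((nat \<Rightarrow> real) \<Rightarrow> nat \<Rightarrow> real) \<Rightarrow> bool" where
  "smooth_map k l F \<longleftrightarrow> F \<in> Rsp k \<rightarrow> Rsp l \<and> (\<forall>a<l. \<forall>m. C_m k m (\<lambda>x. F x a))"

text \<open>Smoothness on $\mathbb R^k \times \mathbb R^k$, identified with $\mathbb R^{2k}$ by
  concatenation of coordinates.\<close>

definition smooth_map2 ::
    "nat \<Rightarrow> ((nat \<Rightarrow> real) \<Rightarrow> (nat \<Rightarrow> real) \<Rightarrow> nat \<Rightarrow> real) \<Rightarrow> bool" where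
  "smooth_map2 k h \<longleftrightarrow>
     smooth_map (2 * k) k
       (\<lambda>z. h (\<lambda>a. if a < k then z a else 0) (\<lambda>a. if a < k then z (k + a) else 0))"


section \<open>Input-additive coupled cell systems\<close>

text \<open>The system $\dot x_j = g(x_j) + \sum_i w_{ji} h(x_j,x_i)$ is represented by its vector field.
  Only its restriction to $(\mathbb R^k)^n$ matters.\<close>

definition coupled_field ::
    "real^'n^'n \<Rightarrow> ((nat \<Rightarrow> real) \<Rightarrow> nat \<Rightarrow> real) \<Rightarrow>
     ((nat \<Rightarrow> real) \<Rightarrow> (nat \<Rightarrow> real) \<Rightarrow> nat \<Rightarrow> real) \<Rightarrow>
     ('n \<Rightarrow> nat \<Rightarrow> real) \<Rightarrow> 'n \<Rightarrow> nat \<Rightarrow> real" where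
  "coupled_field W g h x j a = g (x j) a + (\<Sum>i\<in>UNIV. W $ j $ i * h (x j) (x i) a)"

definition odd_on :: "nat \<Rightarrow> ((nat \<Rightarrow> real) \<Rightarrow> nat \<Rightarrow> real) \<Rightarrow> bool" where
  "odd_on k g \<longleftrightarrow> (\<forall>x\<in>Rsp k. g (- x) = - g x)"

definition odd2_on ::
    "nat \<Rightarrow> ((nat \<Rightarrow> real) \<Rightarrow> (nat \<Rightarrow> real) \<Rightarrow> nat \<Rightarrow> real) \<Rightarrow> bool" where
  "odd2_on k h \<longleftrightarrow> (\<forall>x\<in>Rsp k. \<forall>y\<in>Rsp k. h (- x) (- y) = - h x y)"

definition even_odd_on ::
    "nat \<Rightarrow> ((nat \<Rightarrow> real) \<Rightarrow> (nat \<Rightarrow> real) \<Rightarrow> nat \<Rightarrow> real) \<Rightarrow> bool" where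
  "even_odd_on k h \<longleftrightarrow> (\<forall>x\<in>Rsp k. \<forall>y\<in>Rsp k. h (- x) y = h x y \<and> h x (- y) = - h x y)"

definition vanishes_on_diagonal ::
    "nat \<Rightarrow> ((nat \<Rightarrow> real) \<Rightarrow> (nat \<Rightarrow> real) \<Rightarrow> nat \<Rightarrow> real) \<Rightarrow> bool" where
  "vanishes_on_diagonal k h \<longleftrightarrow> (\<forall>x\<in>Rsp k. h x x = 0)"

text \<open>Joint linearity on $\mathbb R^k \times \mathbb R^k$.\<close>

definition linear2_on ::
    "nat \<Rightarrow> ((nat \<Rightarrow> real) \<Rightarrow> (nat \<Rightarrow> real) \<Rightarrow> nat \<Rightarrow> real) \<Rightarrow> bool" where
  "linear2_on k h \<longleftrightarrow>
     (\<forall>x\<in>Rsp k. \<forall>y\<in>Rsp k. \<forall>x'\<in>Rsp k. \<forall>y'\<in>Rsp k. h (x + x') (y + y') = h x y + h x' y') \<and>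
     (\<forall>c. \<forall>x\<in>Rsp k. \<forall>y\<in>Rsp k. h (\<lambda>a. c * x a) (\<lambda>a. c * y a) = (\<lambda>a. c * h x y a))"

text \<open>Each class is a family indexed by the dimension \<open>k\<close> of the cell phase space.\<close>

type_synonym 'n system_class = "nat \<Rightarrow> (('n \<Rightarrow> nat \<Rightarrow> real) \<Rightarrow> 'n \<Rightarrow> nat \<Rightarrow> real) set"

definition I_G :: "real^'n^'n \<Rightarrow> 'n system_class" where
  "I_G W k = {coupled_field W g h | g h. smooth_map k k g \<and> smooth_map2 k h}"

definition I_G0 :: "real^'n^'n \<Rightarrow> 'n system_class" where
  "I_G0 W k = {coupled_field W g h | g h. smooth_map k k g \<and> smooth_map2 k h \<and>
     vanishes_on_diagonal k h}"

definition I_Godd :: "real^'n^'n \<Rightarrow> 'n system_class" where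
  "I_Godd W k = {coupled_field W g h | g h. smooth_map k k g \<and> smooth_map2 k h \<and>
     vanishes_on_diagonal k h \<and> odd_on k g \<and> odd2_on k h}"

definition I_Gl :: "real^'n^'n \<Rightarrow> 'n system_class" where
  "I_Gl W k = {coupled_field W g h | g h. smooth_map k k g \<and> smooth_map2 k h \<and>
     vanishes_on_diagonal k h \<and> odd_on k g \<and> linear2_on k h}"

definition I_Geo :: "real^'n^'n \<Rightarrow> 'n system_class" where
  "I_Geo W k = {coupled_field W g h | g h. smooth_map k k g \<and> smooth_map2 k h \<and>
     odd_on k g \<and> even_odd_on k h}"


section \<open>Flow invariance, synchrony and anti-synchrony subspaces\<close>

definition solution_on ::
    "nat \<Rightarrow> (('n \<Rightarrow> nat \<Rightarrow> real) \<Rightarrow> 'n \<Rightarrow> nat \<Rightarrow> real) \<Rightarrow> real set \<Rightarrow>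
     (real \<Rightarrow> 'n \<Rightarrow> nat \<Rightarrow> real) \<Rightarrow> bool" where
  "solution_on k f J x \<longleftrightarrow> (\<forall>t\<in>J. (\<forall>j. x t j \<in> Rsp k) \<and>
     (\<forall>j. \<forall>a<k. ((\<lambda>s. x s j a) has_real_derivative f (x t) j a) (at t)))"

definition flow_invariant ::
    "nat \<Rightarrow> (('n \<Rightarrow> nat \<Rightarrow> real) \<Rightarrow> 'n \<Rightarrow> nat \<Rightarrow> real) \<Rightarrow> ('n \<Rightarrow> nat \<Rightarrow> real) set \<Rightarrow> bool" where
  "flow_invariant k f S \<longleftrightarrow>
     (\<forall>J x. open J \<and> is_interval J \<and> 0 \<in> J \<and> solution_on k f J x \<and> x 0 \<in> S \<longrightarrow> (\<forall>t\<in>J. x t \<in> S))"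

definition synchrony_subspace :: "'n system_class \<Rightarrow> 'n tagged_partition \<Rightarrow> bool" where
  "synchrony_subspace \<C> \<P> \<longleftrightarrow> is_standard \<P> \<and>
     (\<forall>k\<ge>1. \<forall>f\<in>\<C> k. flow_invariant k f (polydiagonal_k k \<P>))"

definition antisynchrony_subspace :: "'n system_class \<Rightarrow> 'n tagged_partition \<Rightarrow> bool" where
  "antisynchrony_subspace \<C> \<P> \<longleftrightarrow> \<not> is_standard \<P> \<and>
     (\<forall>k\<ge>1. \<forall>f\<in>\<C> k. flow_invariant k f (polydiagonal_k k \<P>))"

end

theory Submission
  imports Defs
begin

text \<open>Flow invariance of $\Delta_{\mathcal P}$ amounts to tangency of the vector field to
  $\Delta_{\mathcal P}$. If the field is tangent and $\pi$ is a coordinatewise projection onto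
  $\Delta_{\mathcal P}$, then $u = x - \pi x$ satisfies $|u'| \le L |u|$ along a solution $x$ on a
  compact time interval, because the field is Lipschitz on bounded sets; hence $u$ vanishes once it
  does so at time $0$.

  Conversely, take $k = 2$, $g = 0$ and $h((u,s),(u',s')) = (\varphi(s,s'), 0)$ with a polynomial
  $\varphi$. Then $s$ is constant and $u$ is affine in time, so invariance says that
  $(\sum_i w_{ci}\, \varphi(s_c, s_i))_c$ lies in the polydiagonal whenever $s$ does. The choices
  $\varphi = s'$ and $\varphi = s' - s$ give invariance under $W_G$ and $L_G$; for odd-balance one
  separates the parts with $s = \pm j$ on $P_j$ and $\overline P_j$ and interpolating polynomials.\<close>

section \<open>Smooth functions on coordinate spaces\<close>

text \<open>The coupling term at a cell c is row c of W applied to the vector v_i = h(x_c, x_i),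
  with the first argument frozen. If h vanishes on the diagonal, then v_c = 0, and in row c the
  matrix W acts on v like -L. Two cells of one part freeze the same argument, but a cell and a cell
  of the counterpart freeze x_c and -x_c. Evenness of h in its first argument removes this
  discrepancy, and for linear h the first argument splits off. For a merely odd h neither happens:
  h(-x, z) = -h(x, -z) exchanges every part with its counterpart among the inputs. The row sums of
  the blocks must then be compared one by one, and the input from a part without counterpart has no
  partner. This is why odd-balance is a condition on blocks and not invariance under one
  matrix.\<close>

lemma mem_Rsp: "x \<in> Rsp k \<longleftrightarrow> (\<forall>a\<ge>k. x a = 0)"
  by (simp add: topspace_Euclidean_space)

text \<open>\<open>C_m\<close> recurses through partial derivatives. This class contains the partial
  derivatives of its members, so membership alone yields every \<open>C_m\<close> by induction, and
  it is rich enough for all test couplings.\<close>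

inductive polyfun :: "((nat \<Rightarrow> real) \<Rightarrow> real) \<Rightarrow> bool" where
  polyfun_const: "polyfun (\<lambda>x. c)"
| polyfun_coord: "polyfun (\<lambda>x. x i)"
| polyfun_add: "polyfun F \<Longrightarrow> polyfun G \<Longrightarrow> polyfun (\<lambda>x. F x + G x)"
| polyfun_mult: "polyfun F \<Longrightarrow> polyfun G \<Longrightarrow> polyfun (\<lambda>x. F x * G x)"

lemma polyfun_diff:
  assumes "polyfun F" "polyfun G"
  shows "polyfun (\<lambda>x. F x - G x)"
  using polyfun_add[OF assms(1) polyfun_mult[OF polyfun_const[of "-1"] assms(2)]] by simp

lemma polyfun_poly:
  assumes "polyfun F"
  shows "polyfun (\<lambda>x. poly p (F x))"
proof (induction p)
  case 0
  then show ?case using polyfun_const[of 0] by simp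
next
  case (pCons a p)
  then show ?case
    using polyfun_add[OF polyfun_const polyfun_mult[OF assms pCons.IH]] by simp
qed

lemma continuous_map_polyfun:
  assumes "polyfun F"
  shows "continuous_map (Euclidean_space k) euclideanreal F"
  using assms
proof induction
  case (polyfun_coord i)
  then show ?case
    unfolding Euclidean_space_def
    by (intro continuous_map_from_subtopology continuous_map_product_projection) auto
qed (auto intro: continuous_map_add continuous_map_real_mult)

lemma polyfun_has_partial_derivative:
  assumes "polyfun F"
  shows "\<exists>G. polyfun G \<and> (\<forall>x. ((\<lambda>t. F (x(a := t))) has_real_derivative G x) (at (x a)))"
  using assms
proof induction
  case (polyfun_const c)
  then show ?case
    by (intro exI[of _ "\<lambda>x. 0"]) (auto intro: polyfun.intros)
next
  case (polyfun_coord i)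
  then show ?case
    by (intro exI[of _ "\<lambda>x. if i = a then 1 else 0"])
       (auto intro: polyfun.intros)
next
  case (polyfun_add F G)
  then obtain F' G' where
    "polyfun F'" "\<And>x. ((\<lambda>t. F (x(a := t))) has_real_derivative F' x) (at (x a))"
    "polyfun G'" "\<And>x. ((\<lambda>t. G (x(a := t))) has_real_derivative G' x) (at (x a))"
    by blast
  then show ?case
    by (intro exI[of _ "\<lambda>x. F' x + G' x"]) (auto intro: polyfun.intros simp del: fun_upd_apply intro!: DERIV_add)
next
  case (polyfun_mult F G)
  then obtain F' G' where
    *: "polyfun F'" "\<And>x. ((\<lambda>t. F (x(a := t))) has_real_derivative F' x) (at (x a))"
    "polyfun G'" "\<And>x. ((\<lambda>t. G (x(a := t))) has_real_derivative G' x) (at (x a))"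
    by blast
  have "((\<lambda>t. F (x(a := t)) * G (x(a := t))) has_real_derivative F' x * G x + G' x * F x)
          (at (x a))" for x
    using DERIV_mult[OF *(2)[of x] *(4)[of x]] by simp
  then show ?case
    using * polyfun_mult
    by (intro exI[of _ "\<lambda>x. F' x * G x + G' x * F x"]) (auto intro: polyfun.intros simp del: fun_upd_apply)
qed

lemma C_m_polyfun: "polyfun F \<Longrightarrow> C_m k m F"
proof (induction m arbitrary: F)
  case 0
  then show ?case by (simp add: continuous_map_polyfun)
next
  case (Suc m)
  have "(\<forall>x\<in>Rsp k. (\<lambda>t. F (x(a := t))) differentiable at (x a)) \<and>
        C_m k m (\<lambda>x. deriv (\<lambda>t. F (x(a := t))) (x a))" for a
  proof -
    obtain G where G: "polyfun G"
      "\<And>x. ((\<lambda>t. F (x(a := t))) has_real_derivative G x) (at (x a))"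
      using polyfun_has_partial_derivative[OF Suc.prems] by blast
    \<comment> \<open>The equation holds on all of \<open>nat \<Rightarrow> real\<close> and not
      only on \<open>Rsp k\<close>, so the recursive call in \<open>C_m\<close> can be rewritten to
      the polynomial \<open>G\<close>.\<close>
    have "(\<lambda>x. deriv (\<lambda>t. F (x(a := t))) (x a)) = G"
      using G(2) by (auto intro: DERIV_imp_deriv)
    then show ?thesis
      using G Suc.IH by (auto simp: real_differentiable_def)
  qed
  then show ?case
    using continuous_map_polyfun[OF Suc.prems] by simp
qed

section \<open>Lipschitz estimates on cubes\<close>

definition cube :: "nat \<Rightarrow> real \<Rightarrow> (nat \<Rightarrow> real) set" where
  "cube k M = {x \<in> Rsp k. \<forall>a<k. \<bar>x a\<bar> \<le> M}"

text \<open>The topology is inherited from a product over all natural indices. The cube is a product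
  there as well, with the factor {0} from index k on, so Tychonoff applies.\<close>

lemma compactin_cube: "compactin (Euclidean_space k) (cube k M)"
proof -
  have "cube k M = PiE UNIV (\<lambda>a. if a < k then {-M..M} else {0})"
    unfolding cube_def mem_Rsp PiE_UNIV_domain Pi_def
    by (auto simp: abs_le_iff not_less split: if_splits)
  moreover have "compactin (powertop_real UNIV) (PiE UNIV (\<lambda>a. if a < k then {-M..M} else {0}))"
    by (subst compactin_PiE) auto
  moreover have "cube k M \<subseteq> {x. \<forall>i\<ge>k. x i = 0}"
    by (auto simp: cube_def mem_Rsp)
  ultimately show ?thesis
    unfolding Euclidean_space_def by (auto simp: compactin_subtopology)
qed

lemma partial_derivative_bounded:
  assumes "C_m k 1 F" "a < k"
  shows "\<exists>B. \<forall>x\<in>cube k M. \<bar>deriv (\<lambda>t. F (x(a := t))) (x a)\<bar> \<le> B"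
proof -
  let ?D = "\<lambda>x. deriv (\<lambda>t. F (x(a := t))) (x a)"
  have "continuous_map (Euclidean_space k) euclideanreal ?D"
    using assms by simp
  then have "compact (?D ` cube k M)"
    using image_compactin[OF compactin_cube] by fastforce
  then have "bounded (?D ` cube k M)"
    by (rule compact_imp_bounded)
  then show ?thesis
    unfolding bounded_iff by auto
qed

text \<open>Only partial derivatives are at hand, so x is turned into y one coordinate at a time and
  each change is a mean value estimate in one variable. A cube, unlike a ball, contains all the
  mixed points on the way.\<close>

lemma C_1_Lipschitz_on_cube:
  assumes F: "C_m k 1 F"
  shows "\<exists>L\<ge>0. \<forall>x\<in>cube k M. \<forall>y\<in>cube k M. \<bar>F x - F y\<bar> \<le> L * (\<Sum>a<k. \<bar>x a - y a\<bar>)"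
proof -
  obtain B where B: "\<And>a x. a < k \<Longrightarrow> x \<in> cube k M \<Longrightarrow>
      \<bar>deriv (\<lambda>t. F (x(a := t))) (x a)\<bar> \<le> B a"
    using partial_derivative_bounded[OF F, of _ M] by metis
  \<comment> \<open>The absolute values keep L nonnegative even when M < 0 makes the cube empty and
    B arbitrary.\<close>
  define L where "L = (\<Sum>a<k. \<bar>B a\<bar>)"
  have L: "\<bar>B a\<bar> \<le> L" if "a < k" for a
    unfolding L_def using that by (intro member_le_sum) auto
  have "\<bar>F x - F y\<bar> \<le> L * (\<Sum>a<k. \<bar>x a - y a\<bar>)" if x: "x \<in> cube k M" and y: "y \<in> cube k M" for x y
  proof -
    define z where "z j = (\<lambda>a. if a < j then y a else x a)" for j
    have z: "z j \<in> cube k M" for j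
      using x y by (auto simp: z_def cube_def mem_Rsp)
    have step: "\<bar>F (z (Suc j)) - F (z j)\<bar> \<le> L * \<bar>x j - y j\<bar>" if j: "j < k" for j
    proof -
      let ?f = "\<lambda>t. F ((z j)(j := t))"
      have z1: "z (Suc j) = (z j)(j := y j)" and z0: "z j = (z j)(j := x j)"
        by (auto simp: z_def fun_eq_iff less_Suc_eq)
      \<comment> \<open>\<open>C_m\<close> gives differentiability of a slice only at the coordinate
        of the point through which it runs, so it is applied at the moved point
        \<open>(z j)(j := t)\<close>.\<close>
      have d: "(?f has_field_derivative deriv ?f t) (at t within {- M..M})" if t: "t \<in> {-M..M}" for t
      proof -
        have "(z j)(j := t) \<in> Rsp k"
          using z[of j] j by (auto simp: cube_def mem_Rsp)
        then have "(\<lambda>s. F (((z j)(j := t))(j := s))) differentiable at (((z j)(j := t)) j)"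
          using F j by (simp only: One_nat_def C_m.simps)
        then have "?f differentiable at t" by simp
        then show ?thesis
          by (metis DERIV_deriv_iff_real_differentiable DERIV_subset top_greatest)
      qed
      have b: "norm (deriv ?f t) \<le> L" if t: "t \<in> {-M..M}" for t
      proof -
        have "(z j)(j := t) \<in> cube k M"
          using z[of j] j t by (auto simp: cube_def mem_Rsp)
        from B[OF j this] show ?thesis
          using L[OF j] by simp
      qed
      have "norm (?f (y j) - ?f (x j)) \<le> L * norm (y j - x j)"
        by (rule field_differentiable_bound[OF _ d b])
           (use x y j in \<open>auto simp: cube_def abs_le_iff minus_le_iff\<close>)
      then show ?thesis
        by (simp add: z1[symmetric] z0[symmetric] abs_minus_commute)
    qed
    have "z 0 = x" "z k = y"
      using x y by (auto simp: z_def fun_eq_iff cube_def mem_Rsp)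
    then have "F y - F x = (\<Sum>j<k. F (z (Suc j)) - F (z j))"
      using sum_lessThan_telescope[of "\<lambda>j. F (z j)" k] by simp
    then have "\<bar>F x - F y\<bar> \<le> (\<Sum>j<k. \<bar>F (z (Suc j)) - F (z j)\<bar>)"
      by (metis abs_minus_commute sum_abs)
    also have "\<dots> \<le> (\<Sum>j<k. L * \<bar>x j - y j\<bar>)"
      by (intro sum_mono step) auto
    finally show ?thesis by (simp add: sum_distrib_left)
  qed
  moreover have "L \<ge> 0" by (auto simp: L_def intro: sum_nonneg)
  ultimately show ?thesis by blast
qed

text \<open>The sum of squares E is differentiable even where the absolute values are not, and |E'|
  \<le> K E. Hence E exp(-K s) cannot increase to the right of 0 and E exp(K s) cannot decrease to
  the left of 0. Both vanish at 0 and E is nonnegative.\<close>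

lemma gronwall_zero:
  fixes u u' :: "'i \<Rightarrow> real \<Rightarrow> real"
  assumes A: "finite A" and t: "0 \<in> I" "t \<in> I" "is_interval I"
    and d: "\<And>i s. i \<in> A \<Longrightarrow> s \<in> I \<Longrightarrow> (u i has_real_derivative u' i s) (at s)"
    and L: "\<And>i s. i \<in> A \<Longrightarrow> s \<in> I \<Longrightarrow> \<bar>u' i s\<bar> \<le> L * (\<Sum>j\<in>A. \<bar>u j s\<bar>)"
    and u0: "\<And>i. i \<in> A \<Longrightarrow> u i 0 = 0"
    and i: "i \<in> A"
  shows "u i t = 0"
proof -
  define E where "E s = (\<Sum>i\<in>A. (u i s)\<^sup>2)" for s
  define E' where "E' s = (\<Sum>i\<in>A. 2 * u i s * u' i s)" for s
  \<comment> \<open>The factor 2 comes from differentiating squares, and \<open>card A\<close> from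
    the Cauchy-Schwarz bound of the squared sum of the |u_j| by \<open>card A\<close> times
    E.\<close>
  define K where "K = 2 * \<bar>L\<bar> * card A"
  have dE: "(E has_real_derivative E' s) (at s)" if "s \<in> I" for s
    unfolding E_def E'_def using d that
    by (auto intro!: derivative_eq_intros simp: algebra_simps)
  have bE: "\<bar>E' s\<bar> \<le> K * E s" if s: "s \<in> I" for s
  proof -
    let ?V = "\<Sum>j\<in>A. \<bar>u j s\<bar>"
    have V: "?V \<ge> 0" by (auto intro: sum_nonneg)
    have "\<bar>E' s\<bar> \<le> (\<Sum>i\<in>A. \<bar>2 * u i s * u' i s\<bar>)"
      unfolding E'_def by (rule sum_abs)
    also have "\<dots> \<le> (\<Sum>i\<in>A. 2 * \<bar>u i s\<bar> * (\<bar>L\<bar> * ?V))"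
    proof (rule sum_mono)
      fix i assume i: "i \<in> A"
      have "\<bar>u' i s\<bar> \<le> \<bar>L\<bar> * ?V"
        using L[OF i s] V by (smt (verit) mult_right_mono abs_ge_self)
      then show "\<bar>2 * u i s * u' i s\<bar> \<le> 2 * \<bar>u i s\<bar> * (\<bar>L\<bar> * ?V)"
        by (simp add: abs_mult mult_left_mono)
    qed
    also have "\<dots> = 2 * \<bar>L\<bar> * ?V\<^sup>2"
      by (simp add: sum_distrib_left[symmetric] sum_distrib_right[symmetric] power2_eq_square)
    also have "\<dots> \<le> 2 * \<bar>L\<bar> * (card A * E s)"
      using sum_squared_le_sum_of_squares[of "\<lambda>j. \<bar>u j s\<bar>" A] 
      by (intro mult_left_mono) (auto simp: E_def mult.commute)
    finally show ?thesis by (simp add: K_def)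
  qed
  have E0: "E 0 = 0" using u0 by (simp add: E_def)
  have Epos: "E s \<ge> 0" for s by (auto simp: E_def intro: sum_nonneg)
  have "E t \<le> 0"
  proof (cases "t \<ge> 0")
    case True
    have "E t * exp (- K * t) \<le> E 0 * exp (- K * 0)"
    proof (rule DERIV_nonpos_imp_nonincreasing[OF True])
      fix s assume "0 \<le> s" "s \<le> t"
      then have s: "s \<in> I" using t by (meson mem_is_interval_1_I)
      have "((\<lambda>s. E s * exp (- K * s)) has_real_derivative (E' s - K * E s) * exp (- K * s)) (at s)"
        by (auto intro!: derivative_eq_intros dE s simp: algebra_simps)
      moreover have "(E' s - K * E s) * exp (- K * s) \<le> 0"
        using bE[OF s] by (intro mult_nonpos_nonneg) auto
      ultimately show "\<exists>y. ((\<lambda>s. E s * exp (- K * s)) has_real_derivative y) (at s) \<and> y \<le> 0"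
        by blast
    qed
    then show ?thesis by (simp add: E0 mult_le_0_iff)
  next
    case False
    then have "t \<le> 0" by simp
    have "E t * exp (K * t) \<le> E 0 * exp (K * 0)"
    proof (rule DERIV_nonneg_imp_nondecreasing[OF \<open>t \<le> 0\<close>])
      fix s assume "t \<le> s" "s \<le> 0"
      then have s: "s \<in> I" using t by (meson mem_is_interval_1_I)
      have "((\<lambda>s. E s * exp (K * s)) has_real_derivative (E' s + K * E s) * exp (K * s)) (at s)"
        by (auto intro!: derivative_eq_intros dE s simp: algebra_simps)
      moreover have "(E' s + K * E s) * exp (K * s) \<ge> 0"
        using bE[OF s] by (intro mult_nonneg_nonneg) auto
      ultimately show "\<exists>y. ((\<lambda>s. E s * exp (K * s)) has_real_derivative y) (at s) \<and> 0 \<le> y"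
        by blast
    qed
    then show ?thesis by (simp add: E0 mult_le_0_iff)
  qed
  then have "(\<Sum>i\<in>A. (u i t)\<^sup>2) = 0" using Epos[of t] by (simp add: E_def)
  then show ?thesis using A i by (simp add: sum_nonneg_eq_0_iff)
qed

section \<open>Coordinates for tagged partitions\<close>

definition tag_of :: "'n tagged_partition \<Rightarrow> 'n \<Rightarrow> tag" where
  "tag_of \<P> c = (THE T. T \<in> tags \<P> \<and> c \<in> parts_of \<P> T)"

lemma mem_tags [simp]:
  "Part l \<in> tags \<P> \<longleftrightarrow> l \<in> {1..p_of \<P>}"
  "Counterpart l \<in> tags \<P> \<longleftrightarrow> l \<in> {1..q_of \<P>}"
  "Zero \<in> tags \<P> \<longleftrightarrow> r_of \<P> = 1"
  by (auto simp: tags_def)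

lemma finite_tags [simp]: "finite (tags \<P>)"
  by (simp add: tags_def)

lemma tag_of:
  assumes "is_tagged_partition \<P>"
  shows "tag_of \<P> c \<in> tags \<P>"
    and "T \<in> tags \<P> \<Longrightarrow> c \<in> parts_of \<P> T \<longleftrightarrow> tag_of \<P> c = T"
proof -
  have "c \<in> (\<Union>T\<in>tags \<P>. parts_of \<P> T)"
    using assms by (simp add: is_tagged_partition_def)
  then obtain S where S: "S \<in> tags \<P>" "c \<in> parts_of \<P> S"
    by blast
  have uniq: "T = S" if "T \<in> tags \<P>" "c \<in> parts_of \<P> T" for T
    using assms S that by (auto simp: is_tagged_partition_def disjoint_family_on_def)
  have "tag_of \<P> c = S"
    unfolding tag_of_def by (rule the_equality) (use S uniq in blast)+
  then show "tag_of \<P> c \<in> tags \<P>"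
    "T \<in> tags \<P> \<Longrightarrow> c \<in> parts_of \<P> T \<longleftrightarrow> tag_of \<P> c = T"
    using S uniq by blast+
qed

lemma parts_nonempty:
  assumes "is_tagged_partition \<P>" "T \<in> tags \<P>"
  shows "\<exists>c. c \<in> parts_of \<P> T"
  using assms by (auto simp: is_tagged_partition_def)

lemma gen_polydiagonalD:
  assumes "x \<in> gen_polydiagonal \<P>"
  shows "T \<in> tags \<P> \<Longrightarrow> i \<in> parts_of \<P> T \<Longrightarrow> j \<in> parts_of \<P> T \<Longrightarrow> x j = x i"
    and "l \<in> {1..q_of \<P>} \<Longrightarrow> i \<in> parts_of \<P> (Part l) \<Longrightarrow> j \<in> parts_of \<P> (Counterpart l) \<Longrightarrow>
      x j = - x i"
    and "r_of \<P> = 1 \<Longrightarrow> j \<in> parts_of \<P> Zero \<Longrightarrow> x j = 0"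
  using assms unfolding gen_polydiagonal_def by blast+

text \<open>\<open>\<rho> c\<close> is a representative of the part of \<open>c\<close> or of its counterpart, so that
  \<open>y \<mapsto> (\<lambda>c. \<sigma> c * y (\<rho> c))\<close> is a projection onto the polydiagonal.\<close>

lemma gen_polydiagonal_representation:
  fixes \<P> :: "('n::finite) tagged_partition"
  assumes P: "is_tagged_partition \<P>"
  obtains \<sigma> :: "'n \<Rightarrow> real" and \<rho> :: "'n \<Rightarrow> 'n"
  where "\<And>y. y \<in> gen_polydiagonal \<P> \<longleftrightarrow> (\<forall>c. y c = \<sigma> c * y (\<rho> c))"
    and "\<And>c. \<sigma> c \<in> {-1, 0, 1}"
    and "\<And>c. \<rho> (\<rho> c) = \<rho> c"
    and "\<And>c. \<sigma> c * \<sigma> (\<rho> c) = \<sigma> c"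
proof -
  define rep where "rep l = (SOME i. i \<in> parts_of \<P> (Part l))" for l
  define \<sigma> :: "'n \<Rightarrow> real" where
    "\<sigma> c = (case tag_of \<P> c of Part l \<Rightarrow> 1 | Counterpart l \<Rightarrow> -1 | Zero \<Rightarrow> 0)" for c
  \<comment> \<open>A counterpart borrows the representative of its partner, where the sign is 1. A
    cell of the zero part represents itself, which keeps \<open>\<rho>\<close> idempotent there
    while the factor 0 discards its value.\<close>
  define \<rho> where
    "\<rho> c = (case tag_of \<P> c of Part l \<Rightarrow> rep l | Counterpart l \<Rightarrow> rep l | Zero \<Rightarrow> c)" for c
  have qp: "q_of \<P> \<le> p_of \<P>" using P by (simp add: is_tagged_partition_def)
  have rep: "tag_of \<P> (rep l) = Part l" if "l \<in> {1..p_of \<P>}" for l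
  proof -
    have "rep l \<in> parts_of \<P> (Part l)"
      unfolding rep_def by (rule someI_ex[OF parts_nonempty[OF P]]) (use that in auto)
    then show ?thesis using tag_of(2)[OF P, of "Part l"] that by auto
  qed
  note T = tag_of[OF P]
  have tagcases: "(\<exists>l\<in>{1..p_of \<P>}. tag_of \<P> c = Part l \<and> \<sigma> c = 1 \<and> \<rho> c = rep l) \<or>
     (\<exists>l\<in>{1..q_of \<P>}. tag_of \<P> c = Counterpart l \<and> \<sigma> c = -1 \<and> \<rho> c = rep l) \<or>
     (r_of \<P> = 1 \<and> tag_of \<P> c = Zero \<and> \<sigma> c = 0 \<and> \<rho> c = c)" for c
    using T(1)[of c] by (cases "tag_of \<P> c") (auto simp: \<sigma>_def \<rho>_def)
  have 1: "y \<in> gen_polydiagonal \<P> \<longleftrightarrow> (\<forall>c. y c = \<sigma> c * y (\<rho> c))" for y :: "'n \<Rightarrow> real"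
  proof
    assume y: "y \<in> gen_polydiagonal \<P>"
    show "\<forall>c. y c = \<sigma> c * y (\<rho> c)"
    proof
      fix c
      from tagcases[of c] consider
          (part) l where "l \<in> {1..p_of \<P>}" "tag_of \<P> c = Part l" "\<sigma> c = 1" "\<rho> c = rep l"
        | (counterpart) l where "l \<in> {1..q_of \<P>}" "tag_of \<P> c = Counterpart l" "\<sigma> c = -1" "\<rho> c = rep l"
        | (zero) "r_of \<P> = 1" "tag_of \<P> c = Zero" "\<sigma> c = 0" "\<rho> c = c"
        by blast
      then show "y c = \<sigma> c * y (\<rho> c)"
      proof cases
        case part
        then have "rep l \<in> parts_of \<P> (Part l)" "c \<in> parts_of \<P> (Part l)" "Part l \<in> tags \<P>"
          using T(2)[of "Part l"] rep by auto
        from gen_polydiagonalD(1)[OF y this(3,1,2)] show ?thesis using part by simp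
      next
        case counterpart
        then have "rep l \<in> parts_of \<P> (Part l)" "c \<in> parts_of \<P> (Counterpart l)"
          using T(2)[of "Part l"] T(2)[of "Counterpart l"] rep[of l] qp by auto
        from gen_polydiagonalD(2)[OF y counterpart(1) this] show ?thesis using counterpart by simp
      next
        case zero
        then have "c \<in> parts_of \<P> Zero" using T(2)[of Zero] by auto
        from gen_polydiagonalD(3)[OF y zero(1) this] show ?thesis using zero by simp
      qed
    qed
  next
    assume y: "\<forall>c. y c = \<sigma> c * y (\<rho> c)"
    have A: "y j = y i" if "S \<in> tags \<P>" "i \<in> parts_of \<P> S" "j \<in> parts_of \<P> S" for S i j
    proof -
      have "tag_of \<P> i = tag_of \<P> j"
        using that T(2) by auto
      then have "\<sigma> i = \<sigma> j" "\<rho> i = \<rho> j \<or> \<sigma> i = 0"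
        by (auto simp: \<sigma>_def \<rho>_def split: tag.splits)
      then show ?thesis using y by (metis mult_zero_left)
    qed
    have B: "y j = - y i" if "l \<in> {1..q_of \<P>}" "i \<in> parts_of \<P> (Part l)" "j \<in> parts_of \<P> (Counterpart l)"
      for l i j
    proof -
      have "tag_of \<P> i = Part l" "tag_of \<P> j = Counterpart l"
        using that T(2)[of "Part l"] T(2)[of "Counterpart l"] qp by auto
      then have "\<sigma> i = 1" "\<rho> i = rep l" "\<sigma> j = -1" "\<rho> j = rep l"
        by (auto simp: \<sigma>_def \<rho>_def)
      then show ?thesis using y by (metis mult_1 mult_minus1)
    qed
    have C: "y j = 0" if "r_of \<P> = 1" "j \<in> parts_of \<P> Zero" for j
    proof -
      have "tag_of \<P> j = Zero" using that T(2)[of Zero] by auto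
      then have "\<sigma> j = 0" by (auto simp: \<sigma>_def)
      then show ?thesis using y by (metis mult_zero_left)
    qed
    show "y \<in> gen_polydiagonal \<P>"
      unfolding gen_polydiagonal_def using A B C by blast
  qed
  have repq: "tag_of \<P> (rep l) = Part l" if "l \<in> {1..q_of \<P>}" for l
    using rep that qp by auto
  have 2: "\<sigma> c \<in> {-1, 0, 1}" for c using tagcases[of c] by auto
  have 3: "\<rho> (\<rho> c) = \<rho> c" for c
    using tagcases[of c] rep repq by (auto simp: \<rho>_def)
  have 4: "\<sigma> c * \<sigma> (\<rho> c) = \<sigma> c" for c
    using tagcases[of c] rep repq by (auto simp: \<sigma>_def)
  from that 1 2 3 4 show thesis by blast
qed

section \<open>Tangent vector fields leave a polydiagonal invariant\<close>

text \<open>The defining conditions are equations between vectors and can be read one coordinate at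
  a time. This reduces all later arguments to real-valued functions on the cells.\<close>

lemma polydiagonal_k_iff:
  "x \<in> polydiagonal_k k \<P> \<longleftrightarrow>
     (\<forall>a. (\<lambda>c. x c a) \<in> gen_polydiagonal \<P>) \<and> (\<forall>i. x i \<in> Rsp k)"
  unfolding polydiagonal_k_def gen_polydiagonal_def mem_Collect_eq
    fun_eq_iff[where ?'a = nat and ?'b = real] uminus_apply zero_fun_apply
  by blast

lemma sum_lessThan_add:
  fixes f :: "nat \<Rightarrow> 'a::comm_monoid_add"
  shows "(\<Sum>i<m + n. f i) = (\<Sum>i<m. f i) + (\<Sum>i<n. f (m + i))"
  by (induction n) (simp_all add: add.assoc)

lemma smooth_map_Lipschitz_on_cube:
  assumes "smooth_map k l F"
  shows "\<exists>L\<ge>0. \<forall>x\<in>cube k M. \<forall>y\<in>cube k M. \<forall>a<l. \<bar>F x a - F y a\<bar> \<le> L * (\<Sum>b<k. \<bar>x b - y b\<bar>)"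
proof -
  have "\<exists>L\<ge>0. \<forall>x\<in>cube k M. \<forall>y\<in>cube k M. \<bar>F x a - F y a\<bar> \<le> L * (\<Sum>b<k. \<bar>x b - y b\<bar>)" if "a < l" for a
    using assms that unfolding smooth_map_def by (intro C_1_Lipschitz_on_cube) blast
  then obtain L where L: "\<And>a. a < l \<Longrightarrow> L a \<ge> 0"
    "\<And>a x y. a < l \<Longrightarrow> x \<in> cube k M \<Longrightarrow> y \<in> cube k M \<Longrightarrow> \<bar>F x a - F y a\<bar> \<le> L a * (\<Sum>b<k. \<bar>x b - y b\<bar>)"
    by metis
  have "\<bar>F x a - F y a\<bar> \<le> (\<Sum>a<l. L a) * (\<Sum>b<k. \<bar>x b - y b\<bar>)"
    if "a < l" "x \<in> cube k M" "y \<in> cube k M" for a x y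
  proof -
    have "L a \<le> (\<Sum>a<l. L a)"
      using that L(1) by (intro member_le_sum) auto
    then show ?thesis
      using L(2)[OF that] by (smt (verit) mult_right_mono sum_nonneg)
  qed
  moreover have "(\<Sum>a<l. L a) \<ge> 0" using L(1) by (intro sum_nonneg) auto
  ultimately show ?thesis by blast
qed

lemma smooth_map2_Lipschitz_on_cube:
  assumes "smooth_map2 k h"
  shows "\<exists>L\<ge>0. \<forall>x\<in>cube k M. \<forall>y\<in>cube k M. \<forall>x'\<in>cube k M. \<forall>y'\<in>cube k M. \<forall>a<k.
    \<bar>h x y a - h x' y' a\<bar> \<le> L * ((\<Sum>b<k. \<bar>x b - x' b\<bar>) + (\<Sum>b<k. \<bar>y b - y' b\<bar>))"
proof -
  define H where
    "H = (\<lambda>z::nat \<Rightarrow> real. h (\<lambda>a. if a < k then z a else 0) (\<lambda>a. if a < k then z (k + a) else 0))"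
  \<comment> \<open>\<open>cat\<close> inverts the splitting of coordinates in
    \<open>smooth_map2_def\<close>; from index 2k on it vanishes because y does so from index k
    on.\<close>
  define cat :: "(nat \<Rightarrow> real) \<Rightarrow> (nat \<Rightarrow> real) \<Rightarrow> nat \<Rightarrow> real" where
    "cat = (\<lambda>x y a. if a < k then x a else y (a - k))"
  obtain L where L: "L \<ge> 0" "\<And>z z' a. z \<in> cube (2 * k) M \<Longrightarrow> z' \<in> cube (2 * k) M \<Longrightarrow> a < k \<Longrightarrow>
      \<bar>H z a - H z' a\<bar> \<le> L * (\<Sum>b<2 * k. \<bar>z b - z' b\<bar>)"
    using smooth_map_Lipschitz_on_cube[OF assms[unfolded smooth_map2_def], of M] unfolding H_def by blast
  have cat: "cat x y \<in> cube (2 * k) M" "H (cat x y) = h x y"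
    if "x \<in> cube k M" "y \<in> cube k M" for x y
  proof -
    show "cat x y \<in> cube (2 * k) M"
      using that by (auto simp: cat_def cube_def mem_Rsp)
    have "(\<lambda>a. if a < k then cat x y a else 0) = x" "(\<lambda>a. if a < k then cat x y (k + a) else 0) = y"
      using that by (auto simp: cat_def cube_def mem_Rsp fun_eq_iff)
    then show "H (cat x y) = h x y" by (simp add: H_def)
  qed
  have "\<bar>h x y a - h x' y' a\<bar> \<le> L * ((\<Sum>b<k. \<bar>x b - x' b\<bar>) + (\<Sum>b<k. \<bar>y b - y' b\<bar>))"
    if *: "x \<in> cube k M" "y \<in> cube k M" "x' \<in> cube k M" "y' \<in> cube k M" "a < k" for x y x' y' a
  proof -
    have "(\<Sum>b<2 * k. \<bar>cat x y b - cat x' y' b\<bar>) = (\<Sum>b<k. \<bar>x b - x' b\<bar>) + (\<Sum>b<k. \<bar>y b - y' b\<bar>)"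
      unfolding mult_2 sum_lessThan_add by (simp add: cat_def)
    then show ?thesis
      using L(2)[of "cat x y" "cat x' y'" a] cat * by simp
  qed
  then show ?thesis using L(1) by blast
qed

lemma coupled_field_Lipschitz_on_cube:
  fixes W :: "real^'n^'n"
  assumes g: "smooth_map k k g" and h: "smooth_map2 k h"
  shows "\<exists>L\<ge>0. \<forall>x y. (\<forall>i. x i \<in> cube k M) \<longrightarrow> (\<forall>i. y i \<in> cube k M) \<longrightarrow>
    (\<forall>c. \<forall>a<k. \<bar>coupled_field W g h x c a - coupled_field W g h y c a\<bar>
       \<le> L * (\<Sum>(i, b)\<in>UNIV \<times> {..<k}. \<bar>x i b - y i b\<bar>))"
proof -
  obtain G where G: "G \<ge> 0" "\<And>x y a. x \<in> cube k M \<Longrightarrow> y \<in> cube k M \<Longrightarrow> a < k \<Longrightarrow>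
      \<bar>g x a - g y a\<bar> \<le> G * (\<Sum>b<k. \<bar>x b - y b\<bar>)"
    using smooth_map_Lipschitz_on_cube[OF g, of M] by blast
  obtain H where H: "H \<ge> 0" "\<And>x y x' y' a. x \<in> cube k M \<Longrightarrow> y \<in> cube k M \<Longrightarrow> x' \<in> cube k M \<Longrightarrow>
      y' \<in> cube k M \<Longrightarrow> a < k \<Longrightarrow>
      \<bar>h x y a - h x' y' a\<bar> \<le> H * ((\<Sum>b<k. \<bar>x b - x' b\<bar>) + (\<Sum>b<k. \<bar>y b - y' b\<bar>))"
    using smooth_map2_Lipschitz_on_cube[OF h, of M] by blast
  \<comment> \<open>Summing over all rows makes the bound uniform in the cell c. In the constant
    below, 2 * H appears because each of the two arguments of h contributes at most the total
    distance.\<close>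
  define w where "w = (\<Sum>c\<in>UNIV. \<Sum>i\<in>UNIV. \<bar>W $ c $ i\<bar>)"
  have w: "(\<Sum>i\<in>UNIV. \<bar>W $ c $ i\<bar>) \<le> w" for c
    unfolding w_def by (rule member_le_sum) (auto intro: sum_nonneg)
  have "\<bar>coupled_field W g h x c a - coupled_field W g h y c a\<bar>
       \<le> (G + 2 * H * w) * (\<Sum>(i, b)\<in>UNIV \<times> {..<k}. \<bar>x i b - y i b\<bar>)" (is "_ \<le> _ * ?N")
    if x: "\<And>i. x i \<in> cube k M" and y: "\<And>i. y i \<in> cube k M" and a: "a < k" for x y c a
  proof -
    have N: "(\<Sum>b<k. \<bar>x i b - y i b\<bar>) \<le> ?N" for i
      unfolding sum.cartesian_product[symmetric] by (rule member_le_sum) (auto intro: sum_nonneg)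
    have N0: "?N \<ge> 0" by (auto intro: sum_nonneg)
    have "\<bar>W $ c $ i * h (x c) (x i) a - W $ c $ i * h (y c) (y i) a\<bar> \<le> \<bar>W $ c $ i\<bar> * (2 * H * ?N)" for i
    proof -
      have "\<bar>h (x c) (x i) a - h (y c) (y i) a\<bar> \<le> H * (?N + ?N)"
        using H(2)[OF x x y y a] N[of c] N[of i] H(1)
        by (meson add_mono mult_left_mono order_trans)
      then have "\<bar>W $ c $ i\<bar> * \<bar>h (x c) (x i) a - h (y c) (y i) a\<bar> \<le> \<bar>W $ c $ i\<bar> * (H * (?N + ?N))"
        by (rule mult_left_mono) simp
      then show ?thesis
        by (simp add: right_diff_distrib[symmetric] abs_mult)
    qed
    then have "\<bar>\<Sum>i\<in>UNIV. W $ c $ i * h (x c) (x i) a - W $ c $ i * h (y c) (y i) a\<bar>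
        \<le> (\<Sum>i\<in>UNIV. \<bar>W $ c $ i\<bar> * (2 * H * ?N))"
      by (intro order_trans[OF sum_abs] sum_mono)
    also have "\<dots> \<le> w * (2 * H * ?N)"
      unfolding sum_distrib_right[symmetric] using w[of c] H(1) N0 by (intro mult_right_mono) auto
    finally have 1: "\<bar>\<Sum>i\<in>UNIV. W $ c $ i * h (x c) (x i) a - W $ c $ i * h (y c) (y i) a\<bar> \<le> w * (2 * H * ?N)" .
    have 2: "\<bar>g (x c) a - g (y c) a\<bar> \<le> G * ?N"
      using G(2)[OF x y a, of c c] N[of c] G(1) by (meson mult_left_mono order_trans)
    have "\<bar>coupled_field W g h x c a - coupled_field W g h y c a\<bar> \<le> G * ?N + w * (2 * H * ?N)"
      unfolding coupled_field_def using 1 2 by (simp add: sum_subtractf)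
    then show ?thesis by (simp add: algebra_simps)
  qed
  moreover have "w \<ge> 0" by (auto simp: w_def intro!: sum_nonneg)
  then have "G + 2 * H * w \<ge> 0" using G(1) H(1) by simp
  ultimately show ?thesis by blast
qed

text \<open>Lipschitz constants exist only on cubes, so the trajectory has to be confined to one
  over a compact time interval.\<close>

lemma solution_bounded:
  fixes x :: "real \<Rightarrow> 'n::finite \<Rightarrow> nat \<Rightarrow> real"
  assumes sol: "solution_on k f J x" and I: "compact I" "I \<subseteq> J"
  shows "\<exists>M. \<forall>s\<in>I. \<forall>i. x s i \<in> cube k M"
proof -
  have "\<exists>B. \<forall>s\<in>I. \<bar>x s i a\<bar> \<le> B" if "a < k" for i a
  proof -
    have "continuous_on I (\<lambda>s. x s i a)"
      using sol I that unfolding solution_on_def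
      by (intro continuous_at_imp_continuous_on) (blast intro: DERIV_isCont)
    then have "bounded ((\<lambda>s. x s i a) ` I)"
      using I compact_continuous_image compact_imp_bounded by blast
    then show ?thesis by (auto simp: bounded_iff)
  qed
  then have "\<forall>i a. \<exists>B. a < k \<longrightarrow> (\<forall>s\<in>I. \<bar>x s i a\<bar> \<le> B)"
    by blast
  then obtain B where B: "\<And>a i s. a < k \<Longrightarrow> s \<in> I \<Longrightarrow> \<bar>x s i a\<bar> \<le> B i a"
    unfolding choice_iff by blast
  define M where "M = (\<Sum>(i, a)\<in>UNIV \<times> {..<k}. \<bar>B i a\<bar>)"
  have "\<bar>B i a\<bar> \<le> M" if "a < k" for i a
    unfolding M_def using that member_le_sum[of "(i, a)" "UNIV \<times> {..<k}" "\<lambda>(i, a). \<bar>B i a\<bar>"] by auto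
  then have "\<bar>x s i a\<bar> \<le> M" if "a < k" "s \<in> I" for i a s
    using B[OF that, of i] that by (smt (verit))
  moreover have "x s i \<in> Rsp k" if "s \<in> I" for s i
    using sol I that by (auto simp: solution_on_def)
  ultimately show ?thesis by (intro exI[of _ M]) (auto simp: cube_def)
qed

lemma flow_invariant_coupled_field:
  fixes W :: "real^'n^'n" and \<P> :: "'n tagged_partition"
  assumes P: "is_tagged_partition \<P>"
    and g: "smooth_map k k g" and h: "smooth_map2 k h"
    and tangent: "\<And>x a. x \<in> polydiagonal_k k \<P> \<Longrightarrow> a < k \<Longrightarrow>
      (\<lambda>c. coupled_field W g h x c a) \<in> gen_polydiagonal \<P>"
  shows "flow_invariant k (coupled_field W g h) (polydiagonal_k k \<P>)"
  unfolding flow_invariant_def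
proof (intro allI impI ballI, elim conjE)
  fix J :: "real set" and x t
  assume J: "is_interval J" "0 \<in> J" and sol: "solution_on k (coupled_field W g h) J x"
    and x0: "x 0 \<in> polydiagonal_k k \<P>" and t: "t \<in> J"
  let ?f = "coupled_field W g h"
  \<comment> \<open>The segment treats both signs of t at once.\<close>
  define I where "I = closed_segment 0 t"
  have I: "compact I" "I \<subseteq> J" "is_interval I" "0 \<in> I" "t \<in> I"
    using J t closed_segment_subset[of 0 J t]
    by (auto simp: I_def is_interval_convex_1)
  obtain \<sigma> :: "'n \<Rightarrow> real" and \<rho> where
    gp: "\<And>y. y \<in> gen_polydiagonal \<P> \<longleftrightarrow> (\<forall>c. y c = \<sigma> c * y (\<rho> c))"
    and \<sigma>: "\<And>c. \<sigma> c \<in> {-1, 0, 1}" and \<rho>: "\<And>c. \<rho> (\<rho> c) = \<rho> c" and \<sigma>\<rho>: "\<And>c. \<sigma> c * \<sigma> (\<rho> c) = \<sigma> c"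
    using gen_polydiagonal_representation[OF P] by metis
  have \<sigma>1: "\<bar>\<sigma> c\<bar> \<le> 1" for c using \<sigma>[of c] by auto
  have \<sigma>\<rho>': "\<sigma> c * (\<sigma> (\<rho> c) * z) = \<sigma> c * z" for c z using \<sigma>\<rho> by (metis mult.assoc)
  define \<pi> where "\<pi> s = (\<lambda>c a. \<sigma> c * x s (\<rho> c) a)" for s
  obtain M where M: "\<And>s i. s \<in> I \<Longrightarrow> x s i \<in> cube k M"
    using solution_bounded[OF sol I(1,2)] by blast
  \<comment> \<open>Because the factors satisfy |\<sigma>| \<le> 1, projecting does not leave the
    cube, and one Lipschitz constant serves both x and its projection.\<close>
  have \<pi>M: "\<pi> s i \<in> cube k M" if "s \<in> I" for s i
    using M[OF that, of "\<rho> i"] \<sigma>[of i] by (auto simp: \<pi>_def cube_def mem_Rsp abs_mult)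
  have \<pi>: "\<pi> s \<in> polydiagonal_k k \<P>" if "s \<in> I" for s
    using \<pi>M[OF that] unfolding polydiagonal_k_iff gp
    by (auto simp: \<pi>_def cube_def \<rho> \<sigma>\<rho>')
  obtain L where L: "L \<ge> 0" "\<And>x y c a. (\<And>i. x i \<in> cube k M) \<Longrightarrow> (\<And>i. y i \<in> cube k M) \<Longrightarrow> a < k \<Longrightarrow>
      \<bar>?f x c a - ?f y c a\<bar> \<le> L * (\<Sum>(i, b)\<in>UNIV \<times> {..<k}. \<bar>x i b - y i b\<bar>)"
    using coupled_field_Lipschitz_on_cube[OF g h, where W = W and M = M] by blast
  define u where "u ca s = (case ca of (c, a) \<Rightarrow> x s c a - \<sigma> c * x s (\<rho> c) a)" for ca s
  define u' where "u' ca s = (case ca of (c, a) \<Rightarrow> ?f (x s) c a - \<sigma> c * ?f (x s) (\<rho> c) a)" for ca s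
  have "u (c, a) t = 0" if "a < k" for c a
  proof (rule gronwall_zero[where u = u and i = "(c, a)" and t = t and A = "UNIV \<times> {..<k}" and I = I and L = "2 * L" and u' = u'])
    show "(u ca has_real_derivative u' ca s) (at s)" if ca_in: "ca \<in> UNIV \<times> {..<k}" and s: "s \<in> I" for ca s
    proof -
      obtain c a where ca: "ca = (c, a)" "a < k" using ca_in by auto
      have "((\<lambda>s. x s j a) has_real_derivative ?f (x s) j a) (at s)" for j
        using sol s I ca by (auto simp: solution_on_def)
      then show ?thesis
        unfolding u_def u'_def ca(1) by (auto intro!: derivative_eq_intros)
    qed
    show "\<bar>u' ca s\<bar> \<le> 2 * L * (\<Sum>j\<in>UNIV \<times> {..<k}. \<bar>u j s\<bar>)" if ca_in: "ca \<in> UNIV \<times> {..<k}" and s: "s \<in> I" for ca s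
    proof -
      obtain c a where ca: "ca = (c, a)" "a < k" using ca_in by auto
      let ?d = "\<lambda>c. ?f (x s) c a - ?f (\<pi> s) c a"
      \<comment> \<open>Tangency at the projected point allows subtracting 0 from u', which leaves
        only differences of the field between x and its projection. Such differences occur at c and
        at \<open>\<rho> c\<close>, hence the constant 2 * L.\<close>
      have "?f (\<pi> s) c a = \<sigma> c * ?f (\<pi> s) (\<rho> c) a"
        using tangent[OF \<pi>[OF s] ca(2)] unfolding gp by blast
      then have "u' ca s = ?d c - \<sigma> c * ?d (\<rho> c)"
        by (simp add: u'_def ca algebra_simps)
      moreover have "\<bar>?d c\<bar> \<le> L * (\<Sum>j\<in>UNIV \<times> {..<k}. \<bar>u j s\<bar>)" for c
        using L(2)[of "x s" "\<pi> s" a c] M \<pi>M s ca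
        by (auto simp: u_def \<pi>_def case_prod_unfold)
      note this[of c] this[of "\<rho> c"]
      moreover have "\<bar>\<sigma> c * ?d (\<rho> c)\<bar> \<le> \<bar>?d (\<rho> c)\<bar>"
        using \<sigma>1[of c] by (simp add: abs_mult mult_left_le_one_le)
      ultimately show ?thesis by linarith
    qed
    show "u ca 0 = 0" if "ca \<in> UNIV \<times> {..<k}" for ca
    proof -
      obtain c a where ca: "ca = (c, a)" by (cases ca)
      have "x 0 c a = \<sigma> c * x 0 (\<rho> c) a"
        using x0 unfolding polydiagonal_k_iff gp by blast
      then show ?thesis by (simp add: u_def ca)
    qed
  qed (use I that in auto)
  then have "x t c a = \<sigma> c * x t (\<rho> c) a" if "a < k" for c a
    unfolding u_def case_prod_conv right_minus_eq using that by blast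
  moreover have R: "x t c \<in> Rsp k" for c
    using sol t by (auto simp: solution_on_def)
  moreover have "x t c a = 0" if "\<not> a < k" for c a
    using R[of c] that by (auto simp: mem_Rsp)
  ultimately have "x t c a = \<sigma> c * x t (\<rho> c) a" for c a
    by (metis mult_zero_right)
  then show "x t \<in> polydiagonal_k k \<P>"
    unfolding polydiagonal_k_iff gp using R by blast
qed

section \<open>Tangency of balanced systems\<close>

text \<open>Vanishing on the zero part already implies constancy there, so the first premise can
  exclude it. This matters for odd-balance, which does not require the blocks with rows in the zero
  part to be regular.\<close>

lemma gen_polydiagonalI:
  assumes "\<And>T i j. T \<in> tags \<P> \<Longrightarrow> T \<noteq> Zero \<Longrightarrow> i \<in> parts_of \<P> T \<Longrightarrow> j \<in> parts_of \<P> T \<Longrightarrow> x j = x i"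
    and "\<And>l i j. l \<in> {1..q_of \<P>} \<Longrightarrow> i \<in> parts_of \<P> (Part l) \<Longrightarrow> j \<in> parts_of \<P> (Counterpart l) \<Longrightarrow>
      x j = - x i"
    and "\<And>j. r_of \<P> = 1 \<Longrightarrow> j \<in> parts_of \<P> Zero \<Longrightarrow> x j = 0"
  shows "x \<in> gen_polydiagonal \<P>"
proof -
  have "x j = x i" if "T \<in> tags \<P>" "i \<in> parts_of \<P> T" "j \<in> parts_of \<P> T" for T i j
  proof (cases "T = Zero")
    case True
    then have "r_of \<P> = 1" using that(1) by simp
    then have "x i = 0" "x j = 0" using assms(3) that True by blast+
    then show ?thesis by simp
  next
    case False
    then show ?thesis using assms(1) that by blast
  qed
  then show ?thesis
    unfolding gen_polydiagonal_def using assms(2,3) by blast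
qed

lemma gen_polydiagonal_zero: "(\<lambda>c. 0) \<in> (gen_polydiagonal \<P> :: ('n \<Rightarrow> real) set)"
  by (rule gen_polydiagonalI) auto

text \<open>Oddness is asked for only at the values of x, because g and h are odd only on
  \<open>Rsp k\<close>. The value at 0 therefore needs a premise of its own.\<close>

lemma gen_polydiagonal_compose_odd:
  fixes \<phi> :: "'v::{zero,uminus} \<Rightarrow> real"
  assumes x: "x \<in> gen_polydiagonal \<P>"
    and odd: "\<And>i. \<phi> (- x i) = - \<phi> (x i)" and zero: "\<phi> 0 = 0"
  shows "(\<lambda>c. \<phi> (x c)) \<in> gen_polydiagonal \<P>"
proof (rule gen_polydiagonalI)
  show "\<phi> (x j) = \<phi> (x i)" if "T \<in> tags \<P>" "i \<in> parts_of \<P> T" "j \<in> parts_of \<P> T" for T i j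
    using gen_polydiagonalD(1)[OF x that] by (rule arg_cong)
  show "\<phi> (x j) = - \<phi> (x i)"
    if "l \<in> {1..q_of \<P>}" "i \<in> parts_of \<P> (Part l)" "j \<in> parts_of \<P> (Counterpart l)" for l i j
    using gen_polydiagonalD(2)[OF x that] odd by simp
  show "\<phi> (x j) = 0" if "r_of \<P> = 1" "j \<in> parts_of \<P> Zero" for j
    using gen_polydiagonalD(3)[OF x that] zero by simp
qed

lemma gen_polydiagonal_uminus:
  fixes x :: "'n \<Rightarrow> real"
  assumes "x \<in> gen_polydiagonal \<P>"
  shows "(\<lambda>c. - x c) \<in> gen_polydiagonal \<P>"
  using assms by (rule gen_polydiagonal_compose_odd) simp_all

lemma gen_polydiagonal_add:
  fixes x y :: "'n \<Rightarrow> real"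
  assumes x: "x \<in> gen_polydiagonal \<P>" and y: "y \<in> gen_polydiagonal \<P>"
  shows "(\<lambda>c. x c + y c) \<in> gen_polydiagonal \<P>"
proof (rule gen_polydiagonalI)
  show "x j + y j = x i + y i" if "T \<in> tags \<P>" "i \<in> parts_of \<P> T" "j \<in> parts_of \<P> T" for T i j
    using gen_polydiagonalD(1)[OF x that] gen_polydiagonalD(1)[OF y that] by simp
  show "x j + y j = - (x i + y i)"
    if "l \<in> {1..q_of \<P>}" "i \<in> parts_of \<P> (Part l)" "j \<in> parts_of \<P> (Counterpart l)" for l i j
    using gen_polydiagonalD(2)[OF x that] gen_polydiagonalD(2)[OF y that] by simp
  show "x j + y j = 0" if "r_of \<P> = 1" "j \<in> parts_of \<P> Zero" for j
    using gen_polydiagonalD(3)[OF x that] gen_polydiagonalD(3)[OF y that] by simp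
qed

lemma gen_polydiagonal_standard:
  assumes "is_standard \<P>"
  shows "x \<in> gen_polydiagonal \<P> \<longleftrightarrow>
    (\<forall>T\<in>tags \<P>. \<forall>i\<in>parts_of \<P> T. \<forall>j\<in>parts_of \<P> T. x j = x i)"
  using assms by (simp add: gen_polydiagonal_def is_standard_def)

lemma leaves_invariant_polydiagonal_iff:
  fixes M :: "real^'n^'n"
  shows "leaves_invariant M (polydiagonal \<P>) \<longleftrightarrow>
    (\<forall>v\<in>gen_polydiagonal \<P>. (\<lambda>c. \<Sum>i\<in>UNIV. M $ c $ i * v i) \<in> gen_polydiagonal \<P>)"
proof
  assume L: "leaves_invariant M (polydiagonal \<P>)"
  show "\<forall>v\<in>gen_polydiagonal \<P>. (\<lambda>c. \<Sum>i\<in>UNIV. M $ c $ i * v i) \<in> gen_polydiagonal \<P>"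
  proof
    fix v :: "'n \<Rightarrow> real" assume "v \<in> gen_polydiagonal \<P>"
    then have "vec_lambda v \<in> polydiagonal \<P>"
      by (simp add: polydiagonal_def vec_lambda_inverse)
    then have "M *v vec_lambda v \<in> polydiagonal \<P>"
      using L by (auto simp: leaves_invariant_def)
    moreover have "($) (M *v vec_lambda v) = (\<lambda>c. \<Sum>i\<in>UNIV. M $ c $ i * v i)"
      by (auto simp: matrix_vector_mult_def)
    ultimately show "(\<lambda>c. \<Sum>i\<in>UNIV. M $ c $ i * v i) \<in> gen_polydiagonal \<P>"
      by (simp add: polydiagonal_def)
  qed
next
  assume R: "\<forall>v\<in>gen_polydiagonal \<P>. (\<lambda>c. \<Sum>i\<in>UNIV. M $ c $ i * v i) \<in> gen_polydiagonal \<P>"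
  have "($) (M *v x) = (\<lambda>c. \<Sum>i\<in>UNIV. M $ c $ i * x $ i)" for x
    by (auto simp: matrix_vector_mult_def)
  then show "leaves_invariant M (polydiagonal \<P>)"
    using R by (auto simp: leaves_invariant_def polydiagonal_def)
qed

text \<open>The valency in the diagonal entry is distributed over the differences, so -L is the
  field of the coupling h(x, y) = y - x. This form is how vanishing on the diagonal leads to the
  Laplacian.\<close>

lemma laplacian_mult:
  fixes W :: "real^'n^'n"
  shows "(\<Sum>i\<in>UNIV. laplacian W $ c $ i * v i) = - (\<Sum>i\<in>UNIV. W $ c $ i * (v i - v c))"
proof -
  have "laplacian W $ c $ i * v i = (if c = i then (\<Sum>l\<in>UNIV. W $ c $ l) * v c else 0) - W $ c $ i * v i" for i
    by (auto simp: laplacian_def algebra_simps)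
  then have "(\<Sum>i\<in>UNIV. laplacian W $ c $ i * v i) = (\<Sum>l\<in>UNIV. W $ c $ l) * v c - (\<Sum>i\<in>UNIV. W $ c $ i * v i)"
    by (simp add: sum_subtractf)
  then show ?thesis
    by (simp add: right_diff_distrib sum_subtractf sum_distrib_right)
qed

lemma zero_mem_Rsp [simp]: "0 \<in> Rsp k"
  and uminus_mem_Rsp: "x \<in> Rsp k \<Longrightarrow> - x \<in> Rsp k"
  by (auto simp: mem_Rsp)

lemma odd_on_zero:
  assumes "odd_on k g"
  shows "g 0 = 0"
proof
  fix a
  have "g (- 0) = - g 0" using assms unfolding odd_on_def by (metis zero_mem_Rsp)
  then have "g 0 a = - g 0 a" by (metis minus_zero uminus_apply)
  then show "g 0 a = 0 a" by simp
qed

lemma even_odd_on_zero: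
  assumes "even_odd_on k h" "x \<in> Rsp k"
  shows "h x 0 = 0"
proof
  fix a
  have "h x (- 0) = - h x 0" using assms unfolding even_odd_on_def by (metis zero_mem_Rsp)
  then have "h x 0 a = - h x 0 a" by (metis minus_zero uminus_apply)
  then show "h x 0 a = 0 a" by simp
qed

text \<open>Cells i and j of one part have equal states, so both coupling sums apply W to the same
  vector v, which is constant on parts. In the Laplacian case v is 0 at i and at j, so W v and -L v
  agree at these two cells.\<close>

lemma tangent_standard:
  fixes W :: "real^'n^'n"
  assumes P: "is_standard \<P>" and x: "x \<in> polydiagonal_k k \<P>"
    and inv: "leaves_invariant W (polydiagonal \<P>) \<or>
      leaves_invariant (laplacian W) (polydiagonal \<P>) \<and> vanishes_on_diagonal k h"
  shows "(\<lambda>c. coupled_field W g h x c a) \<in> gen_polydiagonal \<P>"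
  unfolding gen_polydiagonal_standard[OF P]
proof (intro ballI)
  fix T i j assume T: "T \<in> tags \<P>" "i \<in> parts_of \<P> T" "j \<in> parts_of \<P> T"
  have gp: "x \<in> gen_polydiagonal \<P>" and R: "\<And>i. x i \<in> Rsp k"
    using x by (auto simp: polydiagonal_k_def)
  have xji: "x j = x i" using gen_polydiagonalD(1)[OF gp T] .
  define v where "v l = h (x i) (x l) a" for l
  have v: "v \<in> gen_polydiagonal \<P>"
    unfolding gen_polydiagonal_standard[OF P]
  proof (intro ballI)
    fix T i' j assume "T \<in> tags \<P>" "i' \<in> parts_of \<P> T" "j \<in> parts_of \<P> T"
    from gen_polydiagonalD(1)[OF gp this] show "v j = v i'" by (simp add: v_def)
  qed
  have "(\<Sum>l\<in>UNIV. W $ j $ l * v l) = (\<Sum>l\<in>UNIV. W $ i $ l * v l)"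
    using inv
  proof
    assume "leaves_invariant W (polydiagonal \<P>)"
    then have "(\<lambda>c. \<Sum>l\<in>UNIV. W $ c $ l * v l) \<in> gen_polydiagonal \<P>"
      using v by (simp add: leaves_invariant_polydiagonal_iff)
    from gen_polydiagonalD(1)[OF this T] show ?thesis .
  next
    assume *: "leaves_invariant (laplacian W) (polydiagonal \<P>) \<and> vanishes_on_diagonal k h"
    then have "(\<lambda>c. \<Sum>l\<in>UNIV. laplacian W $ c $ l * v l) \<in> gen_polydiagonal \<P>"
      using v by (simp add: leaves_invariant_polydiagonal_iff)
    from gen_polydiagonalD(1)[OF this T] 
    have "(\<Sum>l\<in>UNIV. W $ j $ l * (v l - v j)) = (\<Sum>l\<in>UNIV. W $ i $ l * (v l - v i))"
      by (simp add: laplacian_mult)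
    moreover have "v i = 0" "v j = 0"
      using * R by (auto simp: v_def xji vanishes_on_diagonal_def)
    ultimately show ?thesis by simp
  qed
  then show "coupled_field W g h x j a = coupled_field W g h x i a"
    by (simp add: coupled_field_def xji v_def)
qed

text \<open>With the first argument frozen at y, oddness in the second puts l \<mapsto> h(y, x_l)
  into the polydiagonal, and W keeps it there. Evenness lets y = x_i serve the counterpart too,
  where the state is -x_i; on the zero part y = 0.\<close>

lemma tangent_even_odd:
  fixes W :: "real^'n^'n"
  assumes x: "x \<in> polydiagonal_k k \<P>"
    and inv: "leaves_invariant W (polydiagonal \<P>)"
    and g: "odd_on k g" and h: "even_odd_on k h"
  shows "(\<lambda>c. coupled_field W g h x c a) \<in> gen_polydiagonal \<P>"
proof -
  have gp: "x \<in> gen_polydiagonal \<P>" and R: "\<And>i. x i \<in> Rsp k"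
    using x by (auto simp: polydiagonal_k_def)
  have S: "(\<lambda>c. \<Sum>l\<in>UNIV. W $ c $ l * h y (x l) a) \<in> gen_polydiagonal \<P>" if y: "y \<in> Rsp k" for y
  proof -
    have "(\<lambda>l. h y (x l) a) \<in> gen_polydiagonal \<P>"
    proof (rule gen_polydiagonal_compose_odd[OF gp])
      show "h y (- x i) a = - h y (x i) a" for i
        using h R y by (simp add: even_odd_on_def)
      show "h y 0 a = 0" using even_odd_on_zero[OF h y] by simp
    qed
    then show ?thesis using inv by (simp add: leaves_invariant_polydiagonal_iff)
  qed
  show ?thesis
    unfolding coupled_field_def
  proof (rule gen_polydiagonalI)
    fix T i j assume T: "T \<in> tags \<P>" "i \<in> parts_of \<P> T" "j \<in> parts_of \<P> T"
    show "g (x j) a + (\<Sum>l\<in>UNIV. W $ j $ l * h (x j) (x l) a) =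
          g (x i) a + (\<Sum>l\<in>UNIV. W $ i $ l * h (x i) (x l) a)"
      using gen_polydiagonalD(1)[OF gp T] gen_polydiagonalD(1)[OF S[OF R[of i]] T] by simp
  next
    fix l i j assume l: "l \<in> {1..q_of \<P>}" "i \<in> parts_of \<P> (Part l)" "j \<in> parts_of \<P> (Counterpart l)"
    have "g (- x i) = - g (x i)" "\<And>y. y \<in> Rsp k \<Longrightarrow> h (- x i) y = h (x i) y"
      using g h R by (auto simp: odd_on_def even_odd_on_def)
    then show "g (x j) a + (\<Sum>l\<in>UNIV. W $ j $ l * h (x j) (x l) a) =
          - (g (x i) a + (\<Sum>l\<in>UNIV. W $ i $ l * h (x i) (x l) a))"
      using gen_polydiagonalD(2)[OF gp l] gen_polydiagonalD(2)[OF S[OF R[of i]] l] R by simp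
  next
    fix j assume j: "r_of \<P> = 1" "j \<in> parts_of \<P> Zero"
    show "g (x j) a + (\<Sum>l\<in>UNIV. W $ j $ l * h (x j) (x l) a) = 0"
      using gen_polydiagonalD(3)[OF gp j] gen_polydiagonalD(3)[OF S[OF zero_mem_Rsp] j] odd_on_zero[OF g]
      by simp
  qed
qed

text \<open>Subtracting h(x, x) = 0 shows that h depends only on y - x. Writing it as a difference
  of values of \<open>h 0\<close> prepares the use of \<open>laplacian_mult\<close>.\<close>

lemma linear2_on_vanishing_on_diagonal:
  assumes h: "linear2_on k h" "vanishes_on_diagonal k h" and x: "x \<in> Rsp k" and y: "y \<in> Rsp k"
  shows "h x y = h 0 y - h 0 x"
proof -
  have d: "y - x \<in> Rsp k" using x y by (auto simp: mem_Rsp)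
  have "h (x + 0) (x + (y - x)) = h x x + h 0 (y - x)"
    using h(1) x d unfolding linear2_on_def by (metis zero_mem_Rsp)
  moreover have "h (0 + 0) (x + (y - x)) = h 0 x + h 0 (y - x)"
    using h(1) x d unfolding linear2_on_def by (metis zero_mem_Rsp)
  moreover have "h x x = 0" using h(2) x by (simp add: vanishes_on_diagonal_def)
  ultimately show ?thesis by (simp add: algebra_simps)
qed

text \<open>For v_l = h(0, x_l) the coupling term is exactly -L v, and v lies in the polydiagonal
  because linearity makes \<open>h 0\<close> odd.\<close>

lemma tangent_linear:
  fixes W :: "real^'n^'n"
  assumes x: "x \<in> polydiagonal_k k \<P>"
    and inv: "leaves_invariant (laplacian W) (polydiagonal \<P>)"
    and g: "odd_on k g" and h: "linear2_on k h" "vanishes_on_diagonal k h"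
  shows "(\<lambda>c. coupled_field W g h x c a) \<in> gen_polydiagonal \<P>"
proof -
  have gp: "x \<in> gen_polydiagonal \<P>" and R: "\<And>i. x i \<in> Rsp k"
    using x by (auto simp: polydiagonal_k_def)
  define v where "v l = h 0 (x l) a" for l
  have h00: "h 0 0 = 0" using h(2) by (simp add: vanishes_on_diagonal_def)
  have "h 0 (- x i) = - h 0 (x i)" for i
  proof -
    have "h (0 + 0) (x i + - x i) = h 0 (x i) + h 0 (- x i)"
      using h(1) R[of i] uminus_mem_Rsp[OF R[of i]] unfolding linear2_on_def by (metis zero_mem_Rsp)
    then show ?thesis using h00 by (simp add: eq_neg_iff_add_eq_0 add.commute)
  qed
  then have "v \<in> gen_polydiagonal \<P>"
    unfolding v_def by (intro gen_polydiagonal_compose_odd[OF gp, where \<phi> = "\<lambda>z. h 0 z a"]) (auto simp: h00)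
  then have "(\<lambda>c. \<Sum>l\<in>UNIV. laplacian W $ c $ l * v l) \<in> gen_polydiagonal \<P>"
    using inv by (simp add: leaves_invariant_polydiagonal_iff)
  from gen_polydiagonal_uminus[OF this]
  have A: "(\<lambda>c. \<Sum>l\<in>UNIV. W $ c $ l * (v l - v c)) \<in> gen_polydiagonal \<P>"
    by (simp add: laplacian_mult)
  have B: "(\<lambda>c. g (x c) a) \<in> gen_polydiagonal \<P>"
    using g R odd_on_zero[OF g]
    by (intro gen_polydiagonal_compose_odd[OF gp, where \<phi> = "\<lambda>z. g z a"]) (auto simp: odd_on_def)
  have "coupled_field W g h x c a = g (x c) a + (\<Sum>l\<in>UNIV. W $ c $ l * (v l - v c))" for c
    unfolding coupled_field_def v_def
    by (simp add: linear2_on_vanishing_on_diagonal[OF h R R])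
  then show ?thesis using gen_polydiagonal_add[OF B A] by simp
qed

section \<open>Row sums over parts and tangency of odd-balanced systems\<close>

lemma sum_by_parts:
  fixes W :: "real^'n^'n"
  assumes P: "is_tagged_partition \<P>"
  shows "(\<Sum>i\<in>UNIV. W $ c $ i * F (tag_of \<P> i)) = (\<Sum>T\<in>tags \<P>. rs W (parts_of \<P> T) c * F T)"
proof -
  have parts: "parts_of \<P> T = {i. tag_of \<P> i = T}" if "T \<in> tags \<P>" for T
    using tag_of(2)[OF P that] by blast
  have "(\<Sum>T\<in>tags \<P>. rs W (parts_of \<P> T) c * F T)
      = (\<Sum>T\<in>tags \<P>. \<Sum>i | i \<in> UNIV \<and> tag_of \<P> i = T. W $ c $ i * F (tag_of \<P> i))"
    by (rule sum.cong) (auto simp: rs_def parts sum_distrib_right)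
  also have "\<dots> = (\<Sum>i\<in>UNIV. W $ c $ i * F (tag_of \<P> i))"
    by (rule sum.group) (auto intro: tag_of(1)[OF P])
  finally show ?thesis by simp
qed

lemma block_valency_rs_eq:
  assumes "block_valency W \<P> S T v" "i \<in> parts_of \<P> S"
  shows "rs W (parts_of \<P> T) i = v"
  using assms by (simp add: block_valency_def)

lemma same_valency_rs_eq:
  assumes "same_valency W \<P> (S, T) (S', T')" "i \<in> parts_of \<P> S" "j \<in> parts_of \<P> S'"
  shows "rs W (parts_of \<P> T) i = rs W (parts_of \<P> T') j"
  using assms by (auto simp: same_valency_def block_valency_def)

text \<open>This is the effect of x \<mapsto> -x on parts: on paired parts and the zero part, the
  state at \<open>bar_tag \<P> T\<close> is the negative of the state at T. Unpaired parts are fixed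
  only to obtain an involution; there the row sums have to vanish instead.\<close>

definition bar_tag :: "'n tagged_partition \<Rightarrow> tag \<Rightarrow> tag" where
  "bar_tag \<P> T = (case T of
      Part l \<Rightarrow> if l \<le> q_of \<P> then Counterpart l else Part l
    | Counterpart l \<Rightarrow> Part l
    | Zero \<Rightarrow> Zero)"

lemma sum_bar_tag:
  assumes P: "is_tagged_partition \<P>"
  shows "(\<Sum>T\<in>tags \<P>. F (bar_tag \<P> T)) = (\<Sum>T\<in>tags \<P>. F T)"
proof (rule sum.reindex_bij_witness[where i = "bar_tag \<P>" and j = "bar_tag \<P>"])
  have "q_of \<P> \<le> p_of \<P>" using P by (simp add: is_tagged_partition_def)
  then show "bar_tag \<P> T \<in> tags \<P>" "bar_tag \<P> T \<in> tags \<P>"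
    "bar_tag \<P> (bar_tag \<P> T) = T" "bar_tag \<P> (bar_tag \<P> T) = T" if "T \<in> tags \<P>" for T
    using that by (cases T; auto simp: bar_tag_def)+
qed auto

lemma odd_balancedD:
  assumes "odd_balanced W \<P>"
  shows "\<not> is_standard \<P>"
    and "S \<in> tags \<P> \<Longrightarrow> T \<in> tags \<P> \<Longrightarrow> S \<noteq> T \<Longrightarrow> S \<noteq> Zero \<Longrightarrow> \<exists>v. block_valency W \<P> S T v"
    and "i \<in> {1..q_of \<P>} \<Longrightarrow> j \<in> {1..q_of \<P>} \<Longrightarrow> i \<noteq> j \<Longrightarrow>
      same_valency W \<P> (Part i, Part j) (Counterpart i, Counterpart j)"
    and "i \<in> {1..q_of \<P>} \<Longrightarrow> j \<in> {1..q_of \<P>} \<Longrightarrow>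
      same_valency W \<P> (Part i, Counterpart j) (Counterpart i, Part j)"
    and "r_of \<P> = 1 \<Longrightarrow> i \<in> {1..q_of \<P>} \<Longrightarrow> same_valency W \<P> (Part i, Zero) (Counterpart i, Zero)"
    and "r_of \<P> = 1 \<Longrightarrow> j \<in> {1..q_of \<P>} \<Longrightarrow> c \<in> parts_of \<P> Zero \<Longrightarrow>
      rs W (parts_of \<P> (Part j)) c = rs W (parts_of \<P> (Counterpart j)) c"
    and "r_of \<P> = 1 \<Longrightarrow> j \<in> {q_of \<P> + 1..p_of \<P>} \<Longrightarrow> c \<in> parts_of \<P> Zero \<Longrightarrow>
      rs W (parts_of \<P> (Part j)) c = 0"
    and "i \<in> {1..q_of \<P>} \<Longrightarrow> j \<in> {q_of \<P> + 1..p_of \<P>} \<Longrightarrow> block_valency W \<P> (Part i) (Part j) 0"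
    and "i \<in> {1..q_of \<P>} \<Longrightarrow> j \<in> {q_of \<P> + 1..p_of \<P>} \<Longrightarrow> block_valency W \<P> (Counterpart i) (Part j) 0"
  using assms by (simp_all add: odd_balanced_def)

text \<open>Reindexing the inputs of a cell in a counterpart by \<open>bar_tag\<close> turns h(-y,
  -X) into -h(y, X), and the valency conditions cancel it term by term against a cell of the partner
  part. The blocks from a part to itself escape these conditions because h(y, y) = 0. For the zero
  part y = 0, and the same reindexing shows that the sum equals its own negative.\<close>

lemma tangent_odd:
  fixes W :: "real^'n^'n"
  assumes P: "is_tagged_partition \<P>" and x: "x \<in> polydiagonal_k k \<P>"
    and odd: "odd_balanced W \<P>"
    and g: "odd_on k g" and h: "odd2_on k h" "vanishes_on_diagonal k h"
  shows "(\<lambda>c. coupled_field W g h x c a) \<in> gen_polydiagonal \<P>"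
proof -
  have gp: "x \<in> gen_polydiagonal \<P>" and R: "\<And>i. x i \<in> Rsp k"
    using x by (auto simp: polydiagonal_k_def)
  have qp: "q_of \<P> \<le> p_of \<P>" using P by (simp add: is_tagged_partition_def)
  define X where "X T = x (SOME i. i \<in> parts_of \<P> T)" for T
  have X: "x i = X T" if "T \<in> tags \<P>" "i \<in> parts_of \<P> T" for i T
    unfolding X_def
    by (rule gen_polydiagonalD(1)[OF gp that(1) someI_ex that(2)]) (use that in blast)
  have XR: "X T \<in> Rsp k" for T using R by (simp add: X_def)
  have Xbar: "X (Counterpart l) = - X (Part l)" if l: "l \<in> {1..q_of \<P>}" for l
  proof -
    have T: "Part l \<in> tags \<P>" "Counterpart l \<in> tags \<P>" using l qp by auto
    then obtain i j where "i \<in> parts_of \<P> (Part l)" "j \<in> parts_of \<P> (Counterpart l)"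
      using parts_nonempty[OF P] by blast
    then show ?thesis
      using gen_polydiagonalD(2)[OF gp l] X[OF T(1)] X[OF T(2)] by metis
  qed
  have X0: "X Zero = 0" if "r_of \<P> = 1"
  proof -
    have T: "Zero \<in> tags \<P>" using that by simp
    then obtain i where "i \<in> parts_of \<P> Zero"
      using parts_nonempty[OF P] by blast
    then show ?thesis
      using gen_polydiagonalD(3)[OF gp that] X[OF T] by metis
  qed
  define \<nu> where "\<nu> c T = rs W (parts_of \<P> T) c" for c T
  have field: "coupled_field W g h x c a = g (x c) a + (\<Sum>T\<in>tags \<P>. \<nu> c T * h (x c) (X T) a)" for c
  proof -
    have "x i = X (tag_of \<P> i)" for i
      using X tag_of[OF P] by blast
    then have "(\<Sum>i\<in>UNIV. W $ c $ i * h (x c) (x i) a) = (\<Sum>i\<in>UNIV. W $ c $ i * h (x c) (X (tag_of \<P> i)) a)"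
      by metis
    then show ?thesis
      unfolding coupled_field_def \<nu>_def
      by (simp add: sum_by_parts[OF P, where F = "\<lambda>T. h (x c) (X T) a"])
  qed
  have hd: "h y y a = 0" if "y \<in> Rsp k" for y
    using h(2) that by (simp add: vanishes_on_diagonal_def)
  have ho: "h (- y) (- z) a = - h y z a" if "y \<in> Rsp k" "z \<in> Rsp k" for y z
    using h(1) that by (simp add: odd2_on_def)
  have reg: "\<exists>v. block_valency W \<P> S T v" if "S \<in> tags \<P>" "T \<in> tags \<P>" "S \<noteq> T" "S \<noteq> Zero" for S T
    using odd_balancedD(2)[OF odd that] .
  show ?thesis
  proof (rule gen_polydiagonalI)
    fix S i j assume S: "S \<in> tags \<P>" "S \<noteq> Zero" "i \<in> parts_of \<P> S" "j \<in> parts_of \<P> S"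
    have "\<nu> j T * h (X S) (X T) a = \<nu> i T * h (X S) (X T) a" if T: "T \<in> tags \<P>" for T
    proof (cases "S = T")
      case True
      then show ?thesis using hd[OF XR] by simp
    next
      case False
      then obtain v where "block_valency W \<P> S T v" using reg S T by blast
      then show ?thesis using S by (simp add: block_valency_rs_eq \<nu>_def)
    qed
    then have "(\<Sum>T\<in>tags \<P>. \<nu> j T * h (X S) (X T) a) = (\<Sum>T\<in>tags \<P>. \<nu> i T * h (X S) (X T) a)"
      by (rule sum.cong[OF refl])
    then show "coupled_field W g h x j a = coupled_field W g h x i a"
      by (simp only: field X[OF S(1,3)] X[OF S(1,4)])
  next
    fix l i j
    assume l: "l \<in> {1..q_of \<P>}" and i: "i \<in> parts_of \<P> (Part l)" and j: "j \<in> parts_of \<P> (Counterpart l)"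
    let ?y = "X (Part l)"
    have xi: "x i = ?y" and xj: "x j = - ?y"
      using X[of "Part l" i] X[of "Counterpart l" j] Xbar[OF l] l i j qp by auto
    have summand: "\<nu> j (bar_tag \<P> T) * h (- ?y) (X (bar_tag \<P> T)) a = - (\<nu> i T * h ?y (X T) a)"
      if T: "T \<in> tags \<P>" for T
    proof (cases T)
      case (Part m)
      then have m: "m \<in> {1..p_of \<P>}" using T by auto
      show ?thesis
      proof (cases "m \<le> q_of \<P>")
        case True
        then have mq: "m \<in> {1..q_of \<P>}" using m by auto
        have "\<nu> j (Counterpart m) = \<nu> i (Part m)" if "m \<noteq> l"
        proof -
          have "same_valency W \<P> (Part l, Part m) (Counterpart l, Counterpart m)"
            by (rule odd_balancedD(3)[OF odd l mq]) (use that in simp)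
          from same_valency_rs_eq[OF this i j] show ?thesis by (simp add: \<nu>_def)
        qed
        moreover have "h (- ?y) (- X (Part m)) a = - h ?y (X (Part m)) a"
          by (rule ho[OF XR XR])
        ultimately show ?thesis
          using True Part Xbar[OF mq] hd[OF XR, of "Part l"] by (cases "m = l") (simp_all add: bar_tag_def)
      next
        case False
        then have "m \<in> {q_of \<P> + 1..p_of \<P>}" using m by auto
        note odd_balancedD(8,9)[OF odd l this]
        then have "\<nu> i (Part m) = 0" "\<nu> j (Part m) = 0"
          using i j by (simp_all add: block_valency_rs_eq \<nu>_def)
        then show ?thesis using False Part by (simp add: bar_tag_def)
      qed
    next
      case (Counterpart m)
      then have m: "m \<in> {1..q_of \<P>}" using T by auto
      have "same_valency W \<P> (Part l, Counterpart m) (Counterpart l, Part m)"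
        by (rule odd_balancedD(4)[OF odd l m])
      from same_valency_rs_eq[OF this i j] show ?thesis
        using Counterpart Xbar[OF m] ho[OF XR[of "Part l"] XR[of "Counterpart m"]]
        by (simp add: bar_tag_def \<nu>_def)
    next
      case Zero
      then have r: "r_of \<P> = 1" using T by simp
      have "same_valency W \<P> (Part l, Zero) (Counterpart l, Zero)"
        by (rule odd_balancedD(5)[OF odd r l])
      from same_valency_rs_eq[OF this i j] show ?thesis
        using Zero X0[OF r] ho[OF XR[of "Part l"] zero_mem_Rsp] by (simp add: bar_tag_def \<nu>_def)
    qed
    have "(\<Sum>T\<in>tags \<P>. \<nu> j T * h (- ?y) (X T) a)
        = (\<Sum>T\<in>tags \<P>. \<nu> j (bar_tag \<P> T) * h (- ?y) (X (bar_tag \<P> T)) a)"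
      by (rule sum_bar_tag[OF P, symmetric])
    also have "\<dots> = - (\<Sum>T\<in>tags \<P>. \<nu> i T * h ?y (X T) a)"
      using summand by (simp add: sum_negf)
    moreover have "g (- ?y) a = - g ?y a"
      using g XR by (simp add: odd_on_def)
    ultimately show "coupled_field W g h x j a = - coupled_field W g h x i a"
      by (simp add: field xi xj)
  next
    fix j assume r: "r_of \<P> = 1" and j: "j \<in> parts_of \<P> Zero"
    have xj: "x j = 0" using gen_polydiagonalD(3)[OF gp r j] .
    have summand: "\<nu> j (bar_tag \<P> T) * h 0 (X (bar_tag \<P> T)) a = - (\<nu> j T * h 0 (X T) a)"
      if T: "T \<in> tags \<P>" for T
    proof (cases T)
      case (Part m)
      then have m: "m \<in> {1..p_of \<P>}" using T by auto
      show ?thesis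
      proof (cases "m \<le> q_of \<P>")
        case True
        then have mq: "m \<in> {1..q_of \<P>}" using m by auto
        have "\<nu> j (Part m) = \<nu> j (Counterpart m)"
          unfolding \<nu>_def by (rule odd_balancedD(6)[OF odd r mq j])
        then show ?thesis
          using True Part Xbar[OF mq] ho[OF zero_mem_Rsp XR[of "Part m"]] by (simp add: bar_tag_def)
      next
        case False
        then have "m \<in> {q_of \<P> + 1..p_of \<P>}" using m by auto
        then have "\<nu> j (Part m) = 0"
          unfolding \<nu>_def using odd_balancedD(7)[OF odd r _ j] by blast
        then show ?thesis using False Part by (simp add: bar_tag_def)
      qed
    next
      case (Counterpart m)
      then have m: "m \<in> {1..q_of \<P>}" using T by auto
      have "\<nu> j (Part m) = \<nu> j (Counterpart m)"
        unfolding \<nu>_def by (rule odd_balancedD(6)[OF odd r m j])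
      then show ?thesis
        using Counterpart Xbar[OF m] ho[OF zero_mem_Rsp XR[of "Part m"]] by (simp add: bar_tag_def)
    next
      case Zero
      then show ?thesis using X0[OF r] hd[OF zero_mem_Rsp] by (simp add: bar_tag_def)
    qed
    have "(\<Sum>T\<in>tags \<P>. \<nu> j T * h 0 (X T) a)
        = (\<Sum>T\<in>tags \<P>. \<nu> j (bar_tag \<P> T) * h 0 (X (bar_tag \<P> T)) a)"
      by (rule sum_bar_tag[OF P, symmetric])
    also have "\<dots> = - (\<Sum>T\<in>tags \<P>. \<nu> j T * h 0 (X T) a)"
      using summand by (simp add: sum_negf)
    finally show "coupled_field W g h x j a = 0"
      by (simp add: field xj odd_on_zero[OF g])
  qed
qed

section \<open>Necessity of the balance conditions\<close>

text \<open>The second coordinate of every cell is constant in time under this coupling, and it alone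
  drives the first, which therefore grows linearly. Flow invariance can thus be tested on explicit
  solutions, without an existence theorem for differential equations.\<close>

definition drive :: "(real \<Rightarrow> real \<Rightarrow> real) \<Rightarrow> (nat \<Rightarrow> real) \<Rightarrow> (nat \<Rightarrow> real) \<Rightarrow> nat \<Rightarrow> real" where
  "drive \<phi> x y = (\<lambda>a. if a = 0 then \<phi> (x 1) (y 1) else 0)"

lemma smooth_map_zero: "smooth_map k k (\<lambda>x. 0)"
  unfolding smooth_map_def
  by (auto simp: zero_fun_apply mem_Rsp intro!: C_m_polyfun polyfun_const)

text \<open>In the concatenation of two copies of R^2, coordinate 1 of the first argument has index
  1 and that of the second has index 2 + 1 = 3.\<close>

lemma smooth_map2_drive:
  assumes "polyfun (\<lambda>z. \<phi> (z 1) (z 3))"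
  shows "smooth_map2 2 (drive \<phi>)"
proof -
  have drive: "drive \<phi> (\<lambda>a. if a < 2 then z a else 0) (\<lambda>a. if a < 2 then z (2 + a) else 0)
      = (\<lambda>a. if a = 0 then \<phi> (z 1) (z 3) else 0)" for z
    by (rule ext) (simp add: drive_def)
  have "C_m 4 m (\<lambda>z. if a = 0 then \<phi> (z 1) (z 3) else 0)" for m and a :: nat
    using assms by (cases "a = 0") (auto intro!: C_m_polyfun polyfun_const)
  then show ?thesis
    unfolding smooth_map2_def smooth_map_def drive by (auto simp: mem_Rsp)
qed

lemma drive_flow_invariant:
  fixes W :: "real^'n^'n"
  assumes inv: "flow_invariant 2 (coupled_field W (\<lambda>x. 0) (drive \<phi>)) (polydiagonal_k 2 \<P>)"
    and s: "s \<in> gen_polydiagonal \<P>"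
  shows "(\<lambda>c. \<Sum>i\<in>UNIV. W $ c $ i * \<phi> (s c) (s i)) \<in> gen_polydiagonal \<P>"
proof -
  define F where "F = (\<lambda>c. \<Sum>i\<in>UNIV. W $ c $ i * \<phi> (s c) (s i))"
  \<comment> \<open>The first coordinate starts at 0, which is compatible with every polydiagonal,
    and at time 1 it equals the coupling sum F.\<close>
  define x where "x t c a = (if a = 0 then t * F c else if a = 1 then s c else 0)" for t c and a :: nat
  have "solution_on 2 (coupled_field W (\<lambda>x. 0) (drive \<phi>)) UNIV x"
    unfolding solution_on_def
  proof (intro ballI conjI allI impI)
    fix t c show "x t c \<in> Rsp 2" by (auto simp: mem_Rsp x_def)
    fix a :: nat assume "a < 2"
    then consider "a = 0" | "a = 1" by linarith
    then show "((\<lambda>u. x u c a) has_real_derivative coupled_field W (\<lambda>x. 0) (drive \<phi>) (x t) c a) (at t)"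
      by cases (auto simp: x_def coupled_field_def drive_def F_def intro!: derivative_eq_intros)
  qed
  moreover have "x 0 \<in> polydiagonal_k 2 \<P>"
  proof -
    have "(\<lambda>c. x 0 c a) \<in> gen_polydiagonal \<P>" for a
      using s gen_polydiagonal_zero by (cases "a = 0"; cases "a = 1") (simp_all add: x_def)
    then show ?thesis
      unfolding polydiagonal_k_iff by (auto simp: mem_Rsp x_def)
  qed
  ultimately have "x 1 \<in> polydiagonal_k 2 \<P>"
    using inv unfolding flow_invariant_def by blast
  then have "(\<lambda>c. x 1 c 0) \<in> gen_polydiagonal \<P>"
    unfolding polydiagonal_k_iff by blast
  then show ?thesis by (simp add: x_def F_def)
qed

text \<open>The premise quantifies only over the systems of \<open>I_Geo\<close> with k = 2, so
  invariance for the larger class \<open>I_G\<close> implies it as well.\<close>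

lemma invariant_if_flow_invariant:
  fixes W :: "real^'n^'n"
  assumes inv: "\<And>g h. smooth_map 2 2 g \<Longrightarrow> smooth_map2 2 h \<Longrightarrow> odd_on 2 g \<Longrightarrow> even_odd_on 2 h \<Longrightarrow>
    flow_invariant 2 (coupled_field W g h) (polydiagonal_k 2 \<P>)"
  shows "leaves_invariant W (polydiagonal \<P>)"
  unfolding leaves_invariant_polydiagonal_iff
proof
  fix s :: "'n \<Rightarrow> real" assume s: "s \<in> gen_polydiagonal \<P>"
  let ?\<phi> = "\<lambda>s s'::real. s'"
  have "smooth_map2 2 (drive ?\<phi>)"
    by (intro smooth_map2_drive polyfun_coord)
  moreover have "even_odd_on 2 (drive ?\<phi>)"
    by (auto simp: even_odd_on_def drive_def fun_eq_iff)
  ultimately show "(\<lambda>c. \<Sum>i\<in>UNIV. W $ c $ i * s i) \<in> gen_polydiagonal \<P>"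
    using drive_flow_invariant[OF inv s] smooth_map_zero[of 2] by (simp add: odd_on_def)
qed

text \<open>The premise collects the conditions of \<open>I_Godd\<close> and of \<open>I_Gl\<close>,
  so flow invariance for either class discharges it.\<close>

lemma laplacian_invariant_if_flow_invariant:
  fixes W :: "real^'n^'n"
  assumes inv: "\<And>g h. smooth_map 2 2 g \<Longrightarrow> smooth_map2 2 h \<Longrightarrow> odd_on 2 g \<Longrightarrow>
    vanishes_on_diagonal 2 h \<Longrightarrow> odd2_on 2 h \<Longrightarrow> linear2_on 2 h \<Longrightarrow>
    flow_invariant 2 (coupled_field W g h) (polydiagonal_k 2 \<P>)"
  shows "leaves_invariant (laplacian W) (polydiagonal \<P>)"
  unfolding leaves_invariant_polydiagonal_iff
proof
  fix s :: "'n \<Rightarrow> real" assume s: "s \<in> gen_polydiagonal \<P>"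
  let ?\<phi> = "\<lambda>s s'::real. s' - s"
  have "smooth_map2 2 (drive ?\<phi>)"
    by (intro smooth_map2_drive polyfun_diff polyfun_coord)
  moreover have "odd2_on 2 (drive ?\<phi>)" "vanishes_on_diagonal 2 (drive ?\<phi>)" "linear2_on 2 (drive ?\<phi>)"
    by (auto simp: odd2_on_def vanishes_on_diagonal_def linear2_on_def drive_def fun_eq_iff algebra_simps)
  ultimately have "(\<lambda>c. \<Sum>i\<in>UNIV. W $ c $ i * (s i - s c)) \<in> gen_polydiagonal \<P>"
    using drive_flow_invariant[OF inv s] smooth_map_zero[of 2] by (simp add: odd_on_def)
  from gen_polydiagonal_uminus[OF this]
  show "(\<lambda>c. \<Sum>i\<in>UNIV. laplacian W $ c $ i * s i) \<in> gen_polydiagonal \<P>"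
    by (simp add: laplacian_mult)
qed

lemma odd_drive_flow_invariant:
  fixes W :: "real^'n^'n"
  assumes inv: "\<And>g h. smooth_map 2 2 g \<Longrightarrow> smooth_map2 2 h \<Longrightarrow> vanishes_on_diagonal 2 h \<Longrightarrow>
    odd_on 2 g \<Longrightarrow> odd2_on 2 h \<Longrightarrow> flow_invariant 2 (coupled_field W g h) (polydiagonal_k 2 \<P>)"
    and s: "s \<in> gen_polydiagonal \<P>"
    and \<phi>: "polyfun (\<lambda>z. \<phi> (z 1) (z 3))" "\<And>x. \<phi> x x = 0" "\<And>x y. \<phi> (- x) (- y) = - \<phi> x y"
  shows "(\<lambda>c. \<Sum>i\<in>UNIV. W $ c $ i * \<phi> (s c) (s i)) \<in> gen_polydiagonal \<P>"
proof -
  have "smooth_map2 2 (drive \<phi>)"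
    using \<phi>(1) by (rule smooth_map2_drive)
  moreover have "odd2_on 2 (drive \<phi>)" "vanishes_on_diagonal 2 (drive \<phi>)"
    by (auto simp: odd2_on_def vanishes_on_diagonal_def drive_def fun_eq_iff \<phi>)
  ultimately show ?thesis
    using drive_flow_invariant[OF inv s] smooth_map_zero[of 2] by (simp add: odd_on_def)
qed

section \<open>Separating polynomials and the necessity of odd-balance\<close>

lemma poly_indicator:
  fixes A :: "real set"
  assumes "finite A"
  obtains p where "\<And>z. z \<in> A \<Longrightarrow> poly p z = (if z = t then 1 else 0)"
proof -
  \<comment> \<open>Up to scaling this is the Lagrange basis polynomial of t. The point t may lie
    outside A, in which case the result vanishes on all of A.\<close>
  define w where "w = (\<Prod>a\<in>A - {t}. [:- a, 1:])"
  have w: "poly w z = (\<Prod>a\<in>A - {t}. z - a)" for z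
    by (simp add: w_def poly_prod)
  have "poly w t \<noteq> 0" using assms by (simp add: w)
  moreover have "poly w z = 0" if "z \<in> A" "z \<noteq> t" for z
    using assms that by (auto simp: w)
  ultimately show thesis
    by (intro that[of "smult (1 / poly w t) w"]) auto
qed

text \<open>A single state s with distinct values on distinct parts suffices, since an interpolating
  coupling can isolate one row sum at a time. A test at the values m and -m relates the row sum for
  z seen from m to the one for -z seen from -m. The case z = m stays invisible, as it must when h
  vanishes on the diagonal.\<close>

lemma odd_balanced_if_flow_invariant:
  fixes W :: "real^'n^'n"
  assumes P: "is_tagged_partition \<P>" and ns: "\<not> is_standard \<P>"
    and inv: "\<And>g h. smooth_map 2 2 g \<Longrightarrow> smooth_map2 2 h \<Longrightarrow> vanishes_on_diagonal 2 h \<Longrightarrow>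
    odd_on 2 g \<Longrightarrow> odd2_on 2 h \<Longrightarrow> flow_invariant 2 (coupled_field W g h) (polydiagonal_k 2 \<P>)"
  shows "odd_balanced W \<P>"
proof -
  have qp: "q_of \<P> \<le> p_of \<P>" using P by (simp add: is_tagged_partition_def)
  \<comment> \<open>Part numbers start at 1, so the three kinds of tags receive positive, negative
    and zero values, and no two tags collide.\<close>
  define val :: "tag \<Rightarrow> real" where
    "val T = (case T of Part l \<Rightarrow> real l | Counterpart l \<Rightarrow> - real l | Zero \<Rightarrow> 0)" for T
  define s where "s c = val (tag_of \<P> c)" for c
  have val_inj: "T = T'" if "T \<in> tags \<P>" "T' \<in> tags \<P>" "val T = val T'" for T T'
    using that by (cases T; cases T') (auto simp: val_def)
  have sT: "s c = val T" if "T \<in> tags \<P>" "c \<in> parts_of \<P> T" for c T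
    using tag_of(2)[OF P] that by (auto simp: s_def)
  have s: "s \<in> gen_polydiagonal \<P>"
  proof (rule gen_polydiagonalI)
    show "s j = s i" if "T \<in> tags \<P>" "i \<in> parts_of \<P> T" "j \<in> parts_of \<P> T" for T i j
      using that by (simp add: sT)
    show "s j = - s i"
      if "l \<in> {1..q_of \<P>}" "i \<in> parts_of \<P> (Part l)" "j \<in> parts_of \<P> (Counterpart l)" for l i j
      using sT[of "Part l" i] sT[of "Counterpart l" j] that qp by (auto simp: val_def)
    show "s j = 0" if "r_of \<P> = 1" "j \<in> parts_of \<P> Zero" for j
      using sT[of Zero j] that by (auto simp: val_def)
  qed
  \<comment> \<open>Indexing row sums by values turns the passage to the counterpart into z
    \<mapsto> -z. A value that no part has gives 0, so a missing counterpart counts as an empty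
    block.\<close>
  define N where "N c z = (\<Sum>T\<in>tags \<P>. if val T = z then rs W (parts_of \<P> T) c else 0)" for c z
  have N_val: "N c (val T) = rs W (parts_of \<P> T) c" if "T \<in> tags \<P>" for c T
  proof -
    have "N c (val T) = (\<Sum>S\<in>tags \<P>. if S = T then rs W (parts_of \<P> S) c else 0)"
      unfolding N_def using val_inj that by (intro sum.cong) auto
    then show ?thesis using that by simp
  qed
  have N_0: "N c z = 0" if "z \<notin> val ` tags \<P>" for c z
    unfolding N_def using that by (intro sum.neutral) auto
  have sumN: "(\<Sum>i\<in>UNIV. W $ c $ i * (if s i = z then b else 0)) = N c z * b" for c z b
    unfolding s_def sum_by_parts[OF P, where F = "\<lambda>T. if val T = z then b else 0"] N_def sum_distrib_right
    by (intro sum.cong) auto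
  have key: "\<exists>F\<in>gen_polydiagonal \<P>. \<forall>c. (s c = m \<longrightarrow> F c = m * N c z) \<and> (s c = - m \<longrightarrow> F c = - m * N c (- z))"
    if m: "m \<noteq> 0" "z \<noteq> m" for m z
  proof -
    \<comment> \<open>These are all the points where p gets evaluated when s_c is m or -m; m * m
      belongs to the subtracted diagonal term, which vanishes because z differs from m.\<close>
    define A where "A = (\<lambda>T. m * val T) ` tags \<P> \<union> (\<lambda>T. - m * val T) ` tags \<P> \<union> {m * m}"
    have A: "m * s i \<in> A" "- m * s i \<in> A" "m * m \<in> A" for i
      using tag_of(1)[OF P, of i] by (auto simp: A_def s_def)
    have "finite A" by (simp add: A_def)
    from poly_indicator[OF this, of "m * z"] obtain p
      where p: "\<And>y. y \<in> A \<Longrightarrow> poly p y = (if y = m * z then 1 else 0)" by blast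
    \<comment> \<open>odd and zero on the diagonal for every polynomial \<open>p\<close>; this one isolates the cells of value \<open>z\<close>\<close>
    define \<phi> where "\<phi> x y = x * (poly p (x * y) - poly p (x * x))" for x y
    define F where "F c = (\<Sum>i\<in>UNIV. W $ c $ i * \<phi> (s c) (s i))" for c
    have "F \<in> gen_polydiagonal \<P>"
      unfolding F_def
    proof (rule odd_drive_flow_invariant[OF inv s])
      show "polyfun (\<lambda>z. \<phi> (z 1) (z 3))"
        unfolding \<phi>_def by (intro polyfun_mult polyfun_diff polyfun_poly polyfun_coord)
    qed (auto simp: \<phi>_def)
    moreover have "F c = m * N c z" if "s c = m" for c
    proof -
      have "\<phi> (s c) (s i) = (if s i = z then m else 0)" for i
        using m p[OF A(1)[of i]] p[OF A(3)] by (auto simp: \<phi>_def that)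
      then show ?thesis by (simp add: F_def sumN mult.commute)
    qed
    moreover have "F c = - m * N c (- z)" if "s c = - m" for c
    proof -
      have cancel: "- m * s i = m * z \<longleftrightarrow> s i = - z" for i
      proof -
        have "- m * s i = m * (- s i)" by simp
        then show ?thesis using m by (simp only: mult_cancel_left) auto
      qed
      have "\<phi> (s c) (s i) = (if s i = - z then - m else 0)" for i
        using m p[OF A(2)[of i]] p[OF A(3)] cancel[of i] by (auto simp: \<phi>_def that)
      then show ?thesis by (simp add: F_def sumN mult.commute)
    qed
    ultimately show ?thesis by blast
  qed
  have same: "N j z = N i z"
    if "S \<in> tags \<P>" "i \<in> parts_of \<P> S" "j \<in> parts_of \<P> S" "S \<noteq> Zero" "z \<noteq> val S" for S i j z
  proof -
    have "val S \<noteq> 0" using that by (cases S) (auto simp: val_def)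
    from key[OF this that(5)] obtain F where F: "F \<in> gen_polydiagonal \<P>"
      "\<And>c. s c = val S \<Longrightarrow> F c = val S * N c z" by blast
    have "F j = F i" using gen_polydiagonalD(1)[OF F(1) that(1-3)] .
    then show ?thesis using F(2) sT that \<open>val S \<noteq> 0\<close> by simp
  qed
  have opposite: "N j (- z) = N i z"
    if "l \<in> {1..q_of \<P>}" "i \<in> parts_of \<P> (Part l)" "j \<in> parts_of \<P> (Counterpart l)" "z \<noteq> real l" for l i j z
  proof -
    have l: "real l \<noteq> 0" using that by auto
    from key[OF this that(4)] obtain F where F: "F \<in> gen_polydiagonal \<P>"
      "\<And>c. s c = real l \<Longrightarrow> F c = real l * N c z" "\<And>c. s c = - real l \<Longrightarrow> F c = - real l * N c (- z)" by blast
    have "F j = - F i" using gen_polydiagonalD(2)[OF F(1) that(1-3)] .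
    moreover have "s i = real l" "s j = - real l"
      using sT[of "Part l" i] sT[of "Counterpart l" j] that qp by (auto simp: val_def)
    ultimately show ?thesis using F(2)[of i] F(3)[of j] l by simp
  qed
  have zero_row: "N j (- z) = N j z" if r: "r_of \<P> = 1" and j: "j \<in> parts_of \<P> Zero" and z: "z \<noteq> 0" for j z
  proof -
    define A where "A = (\<lambda>T. val T * val T) ` tags \<P>"
    have "finite A" by (simp add: A_def)
    from poly_indicator[OF this, of "z * z"] obtain p
      where p: "\<And>y. y \<in> A \<Longrightarrow> poly p y = (if y = z * z then 1 else 0)" by blast
    \<comment> \<open>the previous choice of \<open>\<phi>\<close> vanishes at \<open>x = 0\<close>, the state of the zero part\<close>
    define \<phi> where "\<phi> x y = y * poly p (y * y) - x * poly p (x * x)" for x y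
    define F where "F c = (\<Sum>i\<in>UNIV. W $ c $ i * \<phi> (s c) (s i))" for c
    have "F \<in> gen_polydiagonal \<P>"
      unfolding F_def
    proof (rule odd_drive_flow_invariant[OF inv s])
      show "polyfun (\<lambda>z. \<phi> (z 1) (z 3))"
        unfolding \<phi>_def by (intro polyfun_mult polyfun_diff polyfun_poly polyfun_coord)
    qed (auto simp: \<phi>_def)
    from gen_polydiagonalD(3)[OF this r j] have "F j = 0" .
    moreover have "s j = 0" using sT[of Zero j] r j by (simp add: val_def)
    \<comment> \<open>The square does not distinguish z from -z, and the outer factor gives them
      opposite signs. The zero part thus sees only the difference of the two row sums, which must be
      0.\<close>
    then have "\<phi> (s j) (s i) = (if s i = z then z else 0) + (if s i = - z then - z else 0)" for i
      using z p[of "s i * s i"] tag_of(1)[OF P, of i] square_eq_iff[of "s i" z]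
      by (auto simp: \<phi>_def A_def s_def)
    then have "F j = N j z * z + N j (- z) * (- z)"
      unfolding F_def by (simp only: distrib_left sum.distrib sumN)
    ultimately show ?thesis using z by simp
  qed
  have unpaired: "- real j \<notin> val ` tags \<P>" if "j \<in> {q_of \<P> + 1..p_of \<P>}" for j
  proof
    assume "- real j \<in> val ` tags \<P>"
    then obtain T where "T \<in> tags \<P>" "- real j = val T" by blast
    then show False using that by (cases T) (auto simp: val_def)
  qed
  have val: "val (Part l) = real l" "val (Counterpart l) = - real l" "val Zero = 0" for l
    by (auto simp: val_def)
  have ex: "\<exists>i j. i \<in> parts_of \<P> (Part l) \<and> j \<in> parts_of \<P> (Counterpart l)" if "l \<in> {1..q_of \<P>}" for l
    using parts_nonempty[OF P, of "Part l"] parts_nonempty[OF P, of "Counterpart l"] that qp by auto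
  \<comment> \<open>One rule covers the three kinds of block pairs, including T = T' =
    \<open>Zero\<close>, through the condition that T and T' have opposite values. The excluded case
    T = \<open>Part i\<close> is the block from a part to itself.\<close>
  have same_valencyI: "same_valency W \<P> (Part i, T) (Counterpart i, T')"
    if i: "i \<in> {1..q_of \<P>}" and T: "T \<in> tags \<P>" "T' \<in> tags \<P>" "val T' = - val T" "T \<noteq> Part i" for i T T'
  proof -
    have Pi: "Part i \<in> tags \<P>" using i qp by auto
    have ne: "val T \<noteq> real i" using val_inj[OF T(1) Pi] T(4) by (auto simp: val)
    obtain c d where c: "c \<in> parts_of \<P> (Part i)" and d: "d \<in> parts_of \<P> (Counterpart i)" using ex[OF i] by blast
    have "N d' (val T') = N c (val T)" if "d' \<in> parts_of \<P> (Counterpart i)" for d'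
      unfolding T(3) by (rule opposite[OF i c that ne])
    moreover have "N c' (val T) = N c (val T)" if "c' \<in> parts_of \<P> (Part i)" for c'
      by (rule same[OF Pi c that]) (use ne in \<open>auto simp: val\<close>)
    ultimately show ?thesis
      unfolding same_valency_def block_valency_def fst_conv snd_conv
      by (intro exI[of _ "N c (val T)"]) (simp add: N_val[OF T(1), symmetric] N_val[OF T(2), symmetric])
  qed
  show ?thesis
    unfolding odd_balanced_def
  proof (intro conjI ballI impI)
    show "\<not> is_standard \<P>" by (rule ns)
  next
    fix S T assume S: "S \<in> tags \<P>" and T: "T \<in> tags \<P>" and ST: "S \<noteq> T \<and> S \<noteq> Zero"
    obtain c where c: "c \<in> parts_of \<P> S" using parts_nonempty[OF P S] by blast
    have "val T \<noteq> val S" using val_inj[OF T S] ST by auto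
    then have "N c' (val T) = N c (val T)" if "c' \<in> parts_of \<P> S" for c'
      using same[OF S c that] ST by blast
    then show "\<exists>v. block_valency W \<P> S T v"
      unfolding block_valency_def using N_val[OF T] by auto
  next
    fix i j assume "i \<in> {1..q_of \<P>}" "j \<in> {1..q_of \<P>}"
    then show "same_valency W \<P> (Part i, Counterpart j) (Counterpart i, Part j)"
      using qp by (intro same_valencyI) (auto simp: val)
    assume "i \<noteq> j"
    then show "same_valency W \<P> (Part i, Part j) (Counterpart i, Counterpart j)"
      using qp \<open>i \<in> {1..q_of \<P>}\<close> \<open>j \<in> {1..q_of \<P>}\<close> by (intro same_valencyI) (auto simp: val)
  next
    fix i assume "r_of \<P> = 1" "i \<in> {1..q_of \<P>}"
    then show "same_valency W \<P> (Part i, Zero) (Counterpart i, Zero)"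
      by (intro same_valencyI) (auto simp: val)
  next
    fix j i assume r: "r_of \<P> = 1" and j: "j \<in> {1..q_of \<P>}" and i: "i \<in> parts_of \<P> Zero"
    have "Part j \<in> tags \<P>" "Counterpart j \<in> tags \<P>" "real j \<noteq> 0" using j qp by auto
    then show "rs W (parts_of \<P> (Part j)) i = rs W (parts_of \<P> (Counterpart j)) i"
      using zero_row[OF r i, of "real j"] N_val[of "Part j"] N_val[of "Counterpart j"] by (simp add: val)
  next
    fix j i assume r: "r_of \<P> = 1" and j: "j \<in> {q_of \<P> + 1..p_of \<P>}" and i: "i \<in> parts_of \<P> Zero"
    have "Part j \<in> tags \<P>" "real j \<noteq> 0" using j by auto
    then show "rs W (parts_of \<P> (Part j)) i = 0"
      using zero_row[OF r i, of "real j"] N_val[of "Part j"] N_0[OF unpaired[OF j]] by (simp add: val)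
  next
    fix i j assume i: "i \<in> {1..q_of \<P>}" and j: "j \<in> {q_of \<P> + 1..p_of \<P>}"
    obtain c d where c: "c \<in> parts_of \<P> (Part i)" and d: "d \<in> parts_of \<P> (Counterpart i)" using ex[OF i] by blast
    have T: "Part j \<in> tags \<P>" using j by auto
    have ne: "real j \<noteq> real i" "- real j \<noteq> real i" using i j by auto
    \<comment> \<open>\<open>opposite\<close> carries the row sum for the value j to the one for -j
      at a cell of the counterpart, and no part has the value -j.\<close>
    have "N c' (real j) = 0" if "c' \<in> parts_of \<P> (Part i)" for c'
      using opposite[OF i that d ne(1)] N_0[OF unpaired[OF j]] by simp
    then show "block_valency W \<P> (Part i) (Part j) 0"
      using N_val[OF T] by (simp add: block_valency_def val)
    have "N d' (real j) = 0" if "d' \<in> parts_of \<P> (Counterpart i)" for d'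
      using opposite[OF i c that ne(2)] N_0[OF unpaired[OF j]] by simp
    then show "block_valency W \<P> (Counterpart i) (Part j) 0"
      using N_val[OF T] by (simp add: block_valency_def val)
  qed
qed

section \<open>The equivalences for the five classes of systems\<close>

theorem theorem11p2:
  fixes W :: "real^'n^'n" and \<P> :: "'n tagged_partition"
  assumes "is_tagged_partition \<P>"
    and "polydiagonal \<P> \<in> invariant_polydiagonals W \<union> invariant_polydiagonals (laplacian W)"
  shows "(synchrony_subspace (I_G W) \<P> \<longleftrightarrow> balanced W \<P>) \<and>
         (synchrony_subspace (I_Geo W) \<P> \<longleftrightarrow> balanced W \<P>) \<and>
         (synchrony_subspace (I_G0 W) \<P> \<longleftrightarrow> exo_balanced W \<P>) \<and>
         (synchrony_subspace (I_Godd W) \<P> \<longleftrightarrow> exo_balanced W \<P>) \<and>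
         (synchrony_subspace (I_Gl W) \<P> \<longleftrightarrow> exo_balanced W \<P>) \<and>
         (antisynchrony_subspace (I_Godd W) \<P> \<longleftrightarrow> odd_balanced W \<P>) \<and>
         (antisynchrony_subspace (I_Gl W) \<P> \<longleftrightarrow> linear_balanced W \<P>) \<and>
         (antisynchrony_subspace (I_Geo W) \<P> \<longleftrightarrow> even_odd_balanced W \<P>)"
proof -
  note P = assms(1)
  note flow = flow_invariant_coupled_field[OF P]
  have G: "synchrony_subspace (I_G W) \<P> \<longleftrightarrow> balanced W \<P>"
  proof
    assume *: "synchrony_subspace (I_G W) \<P>"
    have "flow_invariant 2 (coupled_field W g h) (polydiagonal_k 2 \<P>)"
      if "smooth_map 2 2 g" "smooth_map2 2 h" for g h
    proof -
      have "coupled_field W g h \<in> I_G W 2" unfolding I_G_def using that by blast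
      then show ?thesis using * by (simp add: synchrony_subspace_def)
    qed
    then show "balanced W \<P>"
      using * by (simp add: balanced_def synchrony_subspace_def invariant_if_flow_invariant)
  next
    assume "balanced W \<P>"
    then show "synchrony_subspace (I_G W) \<P>"
      by (auto simp: synchrony_subspace_def balanced_def I_G_def intro!: flow tangent_standard)
  qed
  have eo: "flow_invariant 2 (coupled_field W g h) (polydiagonal_k 2 \<P>)"
    if "\<forall>k\<ge>1. \<forall>f\<in>I_Geo W k. flow_invariant k f (polydiagonal_k k \<P>)"
      "smooth_map 2 2 g" "smooth_map2 2 h" "odd_on 2 g" "even_odd_on 2 h" for g h
  proof -
    have "coupled_field W g h \<in> I_Geo W 2" unfolding I_Geo_def using that by blast
    then show ?thesis using that(1) by simp
  qed
  have l: "flow_invariant 2 (coupled_field W g h) (polydiagonal_k 2 \<P>)"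
    if "\<forall>k\<ge>1. \<forall>f\<in>I_Gl W k. flow_invariant k f (polydiagonal_k k \<P>)"
      "smooth_map 2 2 g" "smooth_map2 2 h" "vanishes_on_diagonal 2 h" "odd_on 2 g" "linear2_on 2 h" for g h
  proof -
    have "coupled_field W g h \<in> I_Gl W 2" unfolding I_Gl_def using that by blast
    then show ?thesis using that(1) by simp
  qed
  have odd: "flow_invariant 2 (coupled_field W g h) (polydiagonal_k 2 \<P>)"
    if "\<forall>k\<ge>1. \<forall>f\<in>I_Godd W k. flow_invariant k f (polydiagonal_k k \<P>)"
      "smooth_map 2 2 g" "smooth_map2 2 h" "vanishes_on_diagonal 2 h" "odd_on 2 g" "odd2_on 2 h" for g h
  proof -
    have "coupled_field W g h \<in> I_Godd W 2" unfolding I_Godd_def using that by blast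
    then show ?thesis using that(1) by simp
  qed
  have Geo: "synchrony_subspace (I_Geo W) \<P> \<longleftrightarrow> balanced W \<P>"
    unfolding synchrony_subspace_def balanced_def
    using invariant_if_flow_invariant eo
    by (auto simp: I_Geo_def intro!: flow tangent_standard)
  have exo: "synchrony_subspace (I_G0 W) \<P>" "synchrony_subspace (I_Godd W) \<P>"
    "synchrony_subspace (I_Gl W) \<P>" if "exo_balanced W \<P>"
    using that
    by (auto simp: synchrony_subspace_def exo_balanced_def I_G0_def I_Godd_def I_Gl_def
        intro!: flow tangent_standard)
  \<comment> \<open>\<open>I_Gl\<close> is a subclass of \<open>I_G0\<close>, so necessity of
    exo-balance for \<open>I_G0\<close> reduces to linear couplings.\<close>
  have G0_imp_Gl: "synchrony_subspace (I_Gl W) \<P>" if "synchrony_subspace (I_G0 W) \<P>"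
    using that unfolding synchrony_subspace_def I_G0_def I_Gl_def by blast
  have Gl: "exo_balanced W \<P>" if "synchrony_subspace (I_Gl W) \<P>"
    using that laplacian_invariant_if_flow_invariant[OF l]
    by (simp add: synchrony_subspace_def exo_balanced_def)
  have Godd: "exo_balanced W \<P>" if "synchrony_subspace (I_Godd W) \<P>"
    using that laplacian_invariant_if_flow_invariant[OF odd]
    by (simp add: synchrony_subspace_def exo_balanced_def)
  have anti_odd: "antisynchrony_subspace (I_Godd W) \<P> \<longleftrightarrow> odd_balanced W \<P>"
  proof
    assume "antisynchrony_subspace (I_Godd W) \<P>"
    then show "odd_balanced W \<P>"
      using odd_balanced_if_flow_invariant[OF P _ odd] by (simp add: antisynchrony_subspace_def)
  next
    assume *: "odd_balanced W \<P>"
    then have "\<not> is_standard \<P>" by (rule odd_balancedD)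
    then show "antisynchrony_subspace (I_Godd W) \<P>"
      by (auto simp: antisynchrony_subspace_def I_Godd_def intro!: flow tangent_odd P *)
  qed
  have anti_l: "antisynchrony_subspace (I_Gl W) \<P> \<longleftrightarrow> linear_balanced W \<P>"
    unfolding antisynchrony_subspace_def linear_balanced_def
    using laplacian_invariant_if_flow_invariant[OF l]
    by (auto simp: I_Gl_def intro!: flow tangent_linear)
  have anti_eo: "antisynchrony_subspace (I_Geo W) \<P> \<longleftrightarrow> even_odd_balanced W \<P>"
    unfolding antisynchrony_subspace_def even_odd_balanced_def
    using invariant_if_flow_invariant eo
    by (auto simp: I_Geo_def intro!: flow tangent_even_odd)
  show ?thesis
    using G Geo exo G0_imp_Gl Gl Godd anti_odd anti_l anti_eo by blast
qed

end
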